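(* Let $p$ be a prime and let $G$ be a finite $p$-solvable group with $G=N_{\mathscr{U}_p}(G)$. Then: (1) $G^{\mathscr{U}_p}$ is a $p$-group; (2) $N_{\mathscr{U}_p}(G/N)>1$ for every proper normal subgroup $N$ of $G$; (3) $h_p(G)\leq 3$.
   Context: All groups are finite. A group is $p$-solvable if each of its chief factors is a $p$-group or a $p'$-group, and $p$-supersolvable if each of its chief factors is either of order $p$ or a $p'$-group. $\mathscr{U}_p$ is the class of $p$-supersolvable groups. For a group $T$, $T^{\mathscr{U}_p}$ is the intersection of all normal subgroups $N$ of $T$ with $T/N\in\mathscr{U}_p$. The norm is $N_{\mathscr{U}_p}(G)=\bigcap_{T\le G}N_G(T^{\mathscr{U}_p})$, over all subgroups $T$ of $G$. $F_p(G)=O_{p'p}(G)$ is the $p$-Fitting subgroup (the largest normal $p$-nilpotent subgroup) of $G$. For $p$-solvable $G$, the $p$-Fitting length $h_p(G)$ is the smallest positive integer $n$ with $F_p^n(G)=G$, where $F_p^0(G)=1$, $F_p^1(G)=F_p(G)$ and $F_p^{i+1}(G)/F_p^i(G)=F_p(G/F_p^i(G))$. *)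

theory Defs
  imports "HOL-Algebra.Algebra" "HOL-Computational_Algebra.Primes"
begin

text \<open>
  Subgroups of \<open>G\<close> are sets; a subgroup \<open>T\<close> is viewed as a group in its own right through
  \<open>G\<lparr>carrier := T\<rparr>\<close>. All notions are meant for finite groups. As \<^const>\<open>order\<close> of an infinite
  group is \<open>0\<close>, for prime \<open>p\<close> neither predicate on orders below holds of an infinite group.
\<close>

definition is_p_group :: "nat \<Rightarrow> ('a, 'b) monoid_scheme \<Rightarrow> bool" where
  "is_p_group p G \<longleftrightarrow> group G \<and> (\<exists>n. order G = p ^ n)"

definition is_p'_group :: "nat \<Rightarrow> ('a, 'b) monoid_scheme \<Rightarrow> bool" where
  "is_p'_group p G \<longleftrightarrow> group G \<and> \<not> p dvd order G"

text \<open>\<open>H/K\<close> is a chief factor: \<open>H/K\<close> is a minimal normal subgroup of \<open>G/K\<close>.\<close>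

definition chief_factor :: "('a, 'b) monoid_scheme \<Rightarrow> 'a set \<Rightarrow> 'a set \<Rightarrow> bool" where
  "chief_factor G H K \<longleftrightarrow> H \<lhd> G \<and> K \<lhd> G \<and> K \<subset> H \<and> \<not> (\<exists>L. L \<lhd> G \<and> K \<subset> L \<and> L \<subset> H)"

definition p_solvable :: "nat \<Rightarrow> ('a, 'b) monoid_scheme \<Rightarrow> bool" where
  "p_solvable p G \<longleftrightarrow>
     (\<forall>H K. chief_factor G H K \<longrightarrow>
        is_p_group p (G\<lparr>carrier := H\<rparr> Mod K) \<or> is_p'_group p (G\<lparr>carrier := H\<rparr> Mod K))"

definition p_supersolvable :: "nat \<Rightarrow> ('a, 'b) monoid_scheme \<Rightarrow> bool" where
  "p_supersolvable p G \<longleftrightarrow>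
     (\<forall>H K. chief_factor G H K \<longrightarrow>
        order (G\<lparr>carrier := H\<rparr> Mod K) = p \<or> is_p'_group p (G\<lparr>carrier := H\<rparr> Mod K))"

definition supersolvable_residual :: "nat \<Rightarrow> ('a, 'b) monoid_scheme \<Rightarrow> 'a set" where
  "supersolvable_residual p T = \<Inter>{N. N \<lhd> T \<and> p_supersolvable p (T Mod N)}"

definition supersolvable_norm :: "nat \<Rightarrow> ('a, 'b) monoid_scheme \<Rightarrow> 'a set" where
  "supersolvable_norm p G =
     (\<Inter>T\<in>{T. subgroup T G}. normalizer G (supersolvable_residual p (G\<lparr>carrier := T\<rparr>)))"

text \<open>
  The largest normal \<open>p\<close>-subgroup and the largest normal \<open>p'\<close>-subgroup, each given as the join of
  all normal subgroups of that kind.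
\<close>

definition O_p :: "nat \<Rightarrow> ('a, 'b) monoid_scheme \<Rightarrow> 'a set" where
  "O_p p G = generate G (\<Union>{N. N \<lhd> G \<and> is_p_group p (G\<lparr>carrier := N\<rparr>)})"

definition O_p' :: "nat \<Rightarrow> ('a, 'b) monoid_scheme \<Rightarrow> 'a set" where
  "O_p' p G = generate G (\<Union>{N. N \<lhd> G \<and> is_p'_group p (G\<lparr>carrier := N\<rparr>)})"

text \<open>
  \<open>F\<^sub>p(G) = O\<^bsub>p'p\<^esub>(G)\<close> is the preimage of \<open>O\<^sub>p(G/O\<^bsub>p'\<^esub>(G))\<close> under \<open>G \<rightarrow> G/O\<^bsub>p'\<^esub>(G)\<close>.
\<close>

definition p_Fitting :: "nat \<Rightarrow> ('a, 'b) monoid_scheme \<Rightarrow> 'a set" where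
  "p_Fitting p G = {x \<in> carrier G. O_p' p G #>\<^bsub>G\<^esub> x \<in> O_p p (G Mod O_p' p G)}"

text \<open>
  The series starts at \<open>1\<close> for index \<open>0\<close>, so that \<open>F\<^sub>p\<^sup>1(G)\<close> is the preimage of \<open>F\<^sub>p(G/1)\<close>, that is,
  \<open>F\<^sub>p(G)\<close>.
\<close>

primrec p_Fitting_series :: "nat \<Rightarrow> ('a, 'b) monoid_scheme \<Rightarrow> nat \<Rightarrow> 'a set" where
  "p_Fitting_series p G 0 = {\<one>\<^bsub>G\<^esub>}"
| "p_Fitting_series p G (Suc i) =
     {x \<in> carrier G. p_Fitting_series p G i #>\<^bsub>G\<^esub> x \<in> p_Fitting p (G Mod p_Fitting_series p G i)}"

text \<open>Meaningful for finite \<open>p\<close>-solvable \<open>G\<close>, where the series does reach \<open>G\<close>.\<close>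

definition p_Fitting_length :: "nat \<Rightarrow> ('a, 'b) monoid_scheme \<Rightarrow> nat" where
  "p_Fitting_length p G = (LEAST n. 0 < n \<and> p_Fitting_series p G n = carrier G)"

end

theory Submission
  imports Defs
begin

text \<open>
  Write \<open>T\<^sup>U\<close> for the residual of \<open>T\<close> with respect to the \<open>p\<close>-supersolvable groups. The hypothesis
  \<open>G = N(G)\<close> says that \<open>T\<^sup>U\<close> is normal in \<open>G\<close> for every subgroup \<open>T\<close> (\<open>norm_eq_carrier_iff\<close>). Residuals
  commute with surjective homomorphisms (\<open>supersolvable_residual_image\<close>), so the hypothesis is
  inherited by quotients. The second claim follows at once: a nontrivial quotient equals its own norm.

  For the first claim, induct on the order of \<open>G\<close>. A nontrivial normal \<open>p\<close>-subgroup may be factored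
  out, so the essential case has a minimal normal \<open>p'\<close>-subgroup \<open>M\<close> with \<open>(G/M)\<^sup>U = L/M\<close> a \<open>p\<close>-group.
  Let \<open>P\<close> be a Sylow \<open>p\<close>-subgroup of \<open>L\<close> and \<open>T = N(P)\<close>. The Frattini argument gives \<open>G = M T\<close>, whence
  \<open>T\<^sup>U M = L\<close>; since \<open>T\<^sup>U\<close> lies in \<open>N(P)\<close>, it contains \<open>P\<close> as its only Sylow \<open>p\<close>-subgroup.
  As \<open>T\<^sup>U\<close> is normal in \<open>G\<close>, so is \<open>P\<close> (\<open>normal_sylow_of_residual\<close>). If \<open>P\<close> is trivial then \<open>G/M\<close>,
  and with it \<open>G\<close>, is \<open>p\<close>-supersolvable; otherwise \<open>P\<close> is a normal \<open>p\<close>-subgroup to factor out.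

  For the third claim, a \<open>p\<close>-supersolvable group has a normal series with factors of type \<open>p'\<close>, \<open>p\<close>, \<open>p'\<close>
  (\<open>p_supersolvable_p_length_nat\<close>). If the group has no nontrivial normal \<open>p'\<close>-subgroup, take a normal
  subgroup \<open>M\<close> of order \<open>p\<close>: its centralizer \<open>C\<close> has \<open>p'\<close>-index, and a normal \<open>p'\<close>-subgroup of the
  quotient by \<open>M\<close>, pulled back and met with \<open>C\<close>, splits over its central Sylow subgroup \<open>M\<close> by transfer
  (\<open>central_coprime_complement\<close>), with a complement that is normal in the whole group and so trivial.
  The middle term of a series of the quotient, pulled back and met with \<open>C\<close>, is then a normal Sylow
  \<open>p\<close>-subgroup. Preceding this series of
  \<open>G/G\<^sup>U\<close> by the \<open>p\<close>-group \<open>G\<^sup>U\<close> gives factors \<open>p\<close>, \<open>p'\<close>, \<open>p\<close>, \<open>p'\<close>, which the \<open>p\<close>-Fitting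
  series covers in three steps (\<open>p_Fitting_series_step\<close>).
\<close>

section \<open>Chief factors under surjective homomorphisms\<close>

lemma chief_factor_normal:
  assumes "chief_factor G A B" shows "A \<lhd> G" "B \<lhd> G" "B \<subset> A"
  using assms by (auto simp: chief_factor_def)

lemma chief_factor_between:
  assumes "chief_factor G A B" "L \<lhd> G" "B \<subseteq> L" "L \<subseteq> A"
  shows "L = B \<or> L = A"
  using assms unfolding chief_factor_def by blast

lemma chief_factorI:
  assumes "A \<lhd> G" "B \<lhd> G" "B \<subset> A" "\<And>L. L \<lhd> G \<Longrightarrow> B \<subset> L \<Longrightarrow> L \<subset> A \<Longrightarrow> False"
  shows "chief_factor G A B"
  using assms unfolding chief_factor_def by blast

lemma (in group) normal_set_mult_normal:
  assumes L: "L \<lhd> G" and B: "B \<lhd> G"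
  shows "L <#> B \<lhd> G" and "L \<subseteq> L <#> B" and "B \<subseteq> L <#> B"
proof -
  have sgL: "subgroup L G" and sgB: "subgroup B G"
    using L B normal_imp_subgroup by blast+
  show "L <#> B \<lhd> G"
  proof (rule normal_invI)
    show "subgroup (L <#> B) G" using L sgB by (rule mult_norm_subgroup)
    fix x y assume x: "x \<in> carrier G" and "y \<in> L <#> B"
    then obtain l b where lb: "l \<in> L" "b \<in> B" "y = l \<otimes> b" by (auto simp: set_mult_def)
    have c: "l \<in> carrier G" "b \<in> carrier G"
      using lb sgL sgB subgroup.mem_carrier by metis+
    have "x \<otimes> y \<otimes> inv x = (x \<otimes> l \<otimes> inv x) \<otimes> (x \<otimes> b \<otimes> inv x)"
      using x c lb(3) by (simp add: m_assoc inv_solve_left)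
    then show "x \<otimes> y \<otimes> inv x \<in> L <#> B"
      using normal_invE(2)[OF L x lb(1)] normal_invE(2)[OF B x lb(2)]
      by (auto simp: set_mult_def)
  qed
  show "L \<subseteq> L <#> B" "B \<subseteq> L <#> B"
    using subgroup.one_closed[OF sgL] subgroup.one_closed[OF sgB]
      subgroup.mem_carrier[OF sgL] subgroup.mem_carrier[OF sgB]
    by (force simp: set_mult_def)+
qed

text \<open>
  A quotient of \<open>G\<close> is represented by any surjective homomorphism with the given kernel. Statements
  about quotients then become statements about pairs of groups whose element types are unrelated,
  which leaves freedom to choose the codomain.
\<close>
locale finite_epimorphism = group_hom G H h
  for G :: "('a, 'b) monoid_scheme" (structure) and H :: "('c, 'd) monoid_scheme" (structure) and h +
  assumes fin: "finite (carrier G)"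
    and surj: "h ` carrier G = carrier H"
begin

definition pre :: "'c set \<Rightarrow> 'a set" where
  "pre A = {x \<in> carrier G. h x \<in> A}"

abbreviation ker :: "'a set" where "ker \<equiv> kernel G H h"

lemma finite_image: "finite (carrier H)"
  using fin surj by (metis finite_imageI)

lemma mem_ker: "x \<in> ker \<longleftrightarrow> x \<in> carrier G \<and> h x = \<one>\<^bsub>H\<^esub>"
  by (simp add: kernel_def)

lemma pre_mono: "A \<subseteq> B \<Longrightarrow> pre A \<subseteq> pre B"
  by (auto simp: pre_def)

lemma subgroup_pre:
  assumes "subgroup A H" shows "subgroup (pre A) G"
  by (rule G.subgroupI)
    (use assms subgroup.one_closed[OF assms] in
      \<open>auto simp: pre_def subgroup.m_inv_closed subgroup.m_closed intro!: exI[of _ "\<one>"]\<close>)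

lemma normal_pre:
  assumes "A \<lhd> H" shows "pre A \<lhd> G"
proof (rule G.normal_invI)
  show "subgroup (pre A) G"
    using assms by (simp add: normal_imp_subgroup subgroup_pre)
  fix x y assume "x \<in> carrier G" "y \<in> pre A"
  then show "x \<otimes> y \<otimes> inv x \<in> pre A"
    using group.normal_invE(2)[OF H.is_group assms, of "h x" "h y"] by (auto simp: pre_def)
qed

lemma normal_image:
  assumes "A \<lhd> G" shows "h ` A \<lhd> H"
  using normal.surj_hom_normal_subgroup[OF assms group_hom_axioms surj] .

lemma image_pre:
  assumes "A \<subseteq> carrier H" shows "h ` pre A = A"
  using assms surj by (auto simp: pre_def)

lemma ker_subset_pre:
  assumes "subgroup A H" shows "ker \<subseteq> pre A"
  using subgroup.one_closed[OF assms] by (auto simp: pre_def mem_ker)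

lemma subset_pre_image:
  assumes "A \<subseteq> carrier G" shows "A \<subseteq> pre (h ` A)"
  using assms by (auto simp: pre_def)

lemma finite_subgroup: "subgroup A G \<Longrightarrow> finite A"
  using fin finite_subset subgroup.subset by blast

text \<open>
  The fibres of \<open>h\<close> on \<open>A\<close> are the cosets of \<open>A \<inter> ker\<close>.
\<close>
lemma card_image_ker:
  assumes A: "subgroup A G"
  shows "card (h ` A) * card (A \<inter> ker) = card A"
proof -
  let ?K = "A \<inter> ker"
  have "card (\<Union>y\<in>h ` A. {x \<in> A. h x = y}) = (\<Sum>y\<in>h ` A. card {x \<in> A. h x = y})"
    by (rule card_UN_disjoint) (use finite_subgroup[OF A] in auto)
  also have "\<dots> = (\<Sum>y\<in>h ` A. card ?K)"
  proof (rule sum.cong[OF refl])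
    fix y assume "y \<in> h ` A"
    then obtain a where a: "a \<in> A" "y = h a" by auto
    have aG: "a \<in> carrier G" using subgroup.mem_carrier[OF A a(1)] .
    have "bij_betw (\<lambda>k. k \<otimes> a) ?K {x \<in> A. h x = y}"
    proof (rule bij_betw_byWitness[where f' = "\<lambda>x. x \<otimes> inv a"])
      show "\<forall>k\<in>?K. k \<otimes> a \<otimes> inv a = k" "\<forall>x\<in>{x \<in> A. h x = y}. x \<otimes> inv a \<otimes> a = x"
        using aG subgroup.mem_carrier[OF A] by (auto simp: G.m_assoc)
      show "(\<lambda>k. k \<otimes> a) ` ?K \<subseteq> {x \<in> A. h x = y}"
        using a aG subgroup.m_closed[OF A] by (auto simp: mem_ker)
      show "(\<lambda>x. x \<otimes> inv a) ` {x \<in> A. h x = y} \<subseteq> ?K"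
        using a aG subgroup.m_closed[OF A] subgroup.m_inv_closed[OF A] subgroup.mem_carrier[OF A]
        by (auto simp: mem_ker)
    qed
    then show "card {x \<in> A. h x = y} = card ?K"
      by (rule bij_betw_same_card[symmetric])
  qed
  also have "(\<Union>y\<in>h ` A. {x \<in> A. h x = y}) = A" by auto
  finally show ?thesis by simp
qed

lemma card_pre:
  assumes "subgroup A H" shows "card (pre A) = card A * card ker"
  using card_image_ker[OF subgroup_pre[OF assms]] ker_subset_pre[OF assms]
    image_pre[OF subgroup.subset[OF assms]]
  by (simp add: Int_absorb1)

lemma order_image: "order H * card ker = order G"
  using card_image_ker[OF G.subgroup_self] surj
  by (metis Int_absorb1 order_def subgroup.subset subgroup_kernel)

lemma chief_factor_pre:
  assumes "chief_factor H A B" shows "chief_factor G (pre A) (pre B)"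
proof -
  have A: "A \<lhd> H" and B: "B \<lhd> H" and BA: "B \<subset> A"
    using assms by (auto simp: chief_factor_def)
  have sA: "A \<subseteq> carrier H" and sB: "B \<subseteq> carrier H"
    using A B by (auto dest: normal_imp_subgroup subgroup.subset)
  show ?thesis
  proof (rule chief_factorI)
    show "pre A \<lhd> G" "pre B \<lhd> G" using A B by (simp_all add: normal_pre)
    show "pre B \<subset> pre A"
      using BA sA sB by (metis image_pre pre_mono psubset_eq)
    fix L assume L: "L \<lhd> G" "pre B \<subset> L" "L \<subset> pre A"
    have kL: "ker \<subseteq> L"
      using ker_subset_pre[OF normal_imp_subgroup[OF B]] L(2) by auto
    have pL: "pre (h ` L) = L"
    proof
      show "pre (h ` L) \<subseteq> L"
      proof
        fix x assume "x \<in> pre (h ` L)"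
        then obtain l where x: "x \<in> carrier G" and l: "l \<in> L" "h x = h l" by (auto simp: pre_def)
        have lG: "l \<in> carrier G" using l L normal_imp_subgroup subgroup.mem_carrier by metis
        have "x \<otimes> inv l \<in> ker" using x l lG by (simp add: mem_ker)
        then have "x \<otimes> inv l \<otimes> l \<in> L"
          using kL l L(1) by (meson normal_imp_subgroup subgroup.m_closed subsetD)
        then show "x \<in> L" using x lG by (simp add: G.m_assoc)
      qed
      show "L \<subseteq> pre (h ` L)"
        using L normal_imp_subgroup subgroup.subset subset_pre_image by metis
    qed
    have "B \<subseteq> h ` L" "h ` L \<subseteq> A"
      using L(2,3) sA sB by (metis image_mono image_pre psubset_imp_subset)+
    then show False
      using chief_factor_between[OF assms normal_image[OF L(1)]] L(2,3) pL by auto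
  qed
qed

lemma card_pre_cross:
  assumes "subgroup A H" "subgroup B H"
  shows "card A * card (pre B) = card B * card (pre A)"
  by (simp add: card_pre assms)

text \<open>
  If \<open>h\<close> separates \<open>A\<close> from \<open>B\<close>, then the intersection of \<open>A\<close> with the full preimage of \<open>h ` B\<close>
  lies between \<open>B\<close> and \<open>A\<close> without being \<open>A\<close>, so it is \<open>B\<close>. Thus \<open>A\<close> and \<open>B\<close> meet the kernel in the
  same subgroup, and the chief factor survives in the image with its order unchanged.
\<close>
lemma chief_factor_image:
  assumes AB: "chief_factor G A B" and ne: "h ` A \<noteq> h ` B"
  shows "chief_factor H (h ` A) (h ` B)" and "card A * card (h ` B) = card B * card (h ` A)"
proof -
  have A: "A \<lhd> G" and B: "B \<lhd> G" and BA: "B \<subset> A"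
    using AB by (auto simp: chief_factor_def)
  have sub: "A \<subseteq> carrier G" "B \<subseteq> carrier G"
    using A B by (auto dest: normal_imp_subgroup subgroup.subset)
  have "A \<inter> pre (h ` B) \<lhd> G"
    using A B by (simp add: normal_image normal_pre G.normal_subgroup_intersect)
  moreover have "B \<subseteq> A \<inter> pre (h ` B)" using BA sub by (auto simp: pre_def)
  moreover have "A \<inter> pre (h ` B) \<noteq> A" using ne BA by (auto simp: pre_def)
  ultimately have eq: "A \<inter> pre (h ` B) = B"
    using chief_factor_between[OF AB] by blast
  have "A \<inter> ker \<subseteq> A \<inter> pre (h ` B)"
    using ker_subset_pre B normal_imp_subgroup subgroup_img_is_subgroup by blast
  then have k: "A \<inter> ker = B \<inter> ker" using eq BA by auto
  show "card A * card (h ` B) = card B * card (h ` A)"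
    unfolding card_image_ker[OF normal_imp_subgroup[OF A], symmetric]
      card_image_ker[OF normal_imp_subgroup[OF B], symmetric] k
    by simp
  show "chief_factor H (h ` A) (h ` B)"
  proof (rule chief_factorI)
    show "h ` A \<lhd> H" "h ` B \<lhd> H" using A B by (simp_all add: normal_image)
    show "h ` B \<subset> h ` A" using ne BA by auto
    fix L assume L: "L \<lhd> H" "h ` B \<subset> L" "L \<subset> h ` A"
    have "A \<inter> pre L \<lhd> G"
      using A L by (simp add: normal_pre G.normal_subgroup_intersect)
    moreover have "B \<subseteq> A \<inter> pre L" using BA sub L by (auto simp: pre_def)
    ultimately have "A \<inter> pre L = B \<or> A \<inter> pre L = A"
      using chief_factor_between[OF AB] by blast
    moreover have "h ` (A \<inter> pre L) = L" using L(3) sub by (fastforce simp: pre_def)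
    ultimately show False using L by auto
  qed
qed

text \<open>
  If \<open>h\<close> identifies \<open>A\<close> with \<open>B\<close>, the chief factor lives entirely inside the kernel: a normal subgroup
  \<open>L\<close> strictly between the two intersections would give the normal subgroup \<open>L B\<close> strictly between
  \<open>B\<close> and \<open>A\<close>, by the modular law.
\<close>
lemma chief_factor_kernel:
  assumes AB: "chief_factor G A B" and eq: "h ` A = h ` B"
  shows "chief_factor G (A \<inter> ker) (B \<inter> ker)"
    and "card A * card (B \<inter> ker) = card B * card (A \<inter> ker)"
proof -
  have A: "A \<lhd> G" and B: "B \<lhd> G" and BA: "B \<subset> A"
    using AB by (auto simp: chief_factor_def)
  have sgA: "subgroup A G" and sgB: "subgroup B G"
    using A B by (auto dest: normal_imp_subgroup)
  have cA: "card (h ` B) * card (A \<inter> ker) = card A" and cB: "card (h ` B) * card (B \<inter> ker) = card B"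
    using card_image_ker[OF sgA] card_image_ker[OF sgB] eq by auto
  show "card A * card (B \<inter> ker) = card B * card (A \<inter> ker)"
    unfolding cA[symmetric] cB[symmetric] by simp
  show "chief_factor G (A \<inter> ker) (B \<inter> ker)"
  proof (rule chief_factorI)
    show "A \<inter> ker \<lhd> G" "B \<inter> ker \<lhd> G"
      using A B normal_kernel by (auto intro: G.normal_subgroup_intersect)
    have "card B < card A" using BA finite_subgroup[OF sgA] by (rule psubset_card_mono[rotated])
    then have "A \<inter> ker \<noteq> B \<inter> ker" using cA cB by auto
    then show "B \<inter> ker \<subset> A \<inter> ker" using BA by auto
    fix L assume L: "L \<lhd> G" "B \<inter> ker \<subset> L" "L \<subset> A \<inter> ker"
    have sgL: "subgroup L G" using L normal_imp_subgroup by blast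
    have J: "L <#> B \<lhd> G" and LJ: "L \<subseteq> L <#> B" and BJ: "B \<subseteq> L <#> B"
      using G.normal_set_mult_normal[OF L(1) B] by auto
    have "L <#> B \<subseteq> A"
      using L(3) BA subgroup.m_closed[OF sgA] by (auto simp: set_mult_def)
    then consider "L <#> B = B" | "L <#> B = A"
      using chief_factor_between[OF AB J BJ] by auto
    then show False
    proof cases
      case 1
      then show False using LJ L by blast
    next
      case 2
      have "A \<inter> ker \<subseteq> L"
      proof
        fix a assume a: "a \<in> A \<inter> ker"
        then obtain l b where lb: "l \<in> L" "b \<in> B" "a = l \<otimes> b" using 2 by (auto simp: set_mult_def)
        have c: "l \<in> carrier G" "b \<in> carrier G"
          using lb subgroup.mem_carrier[OF sgL] subgroup.mem_carrier[OF sgB] by auto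
        have "b \<in> ker"
          using a lb c L(3) by (auto simp: mem_ker)
        then have "b \<in> L" using lb L by auto
        then show "a \<in> L" using lb subgroup.m_closed[OF sgL] by auto
      qed
      then show False using L by auto
    qed
  qed
qed

end

section \<open>Residuals of \<open>p\<close>-supersolvable quotients\<close>

lemma (in group) order_section:
  assumes fin: "finite (carrier G)" and A: "A \<lhd> G" and B: "B \<lhd> G" and BA: "B \<subseteq> A"
  shows "group (G\<lparr>carrier := A\<rparr> Mod B)" and "card A = order (G\<lparr>carrier := A\<rparr> Mod B) * card B"
    and "card B > 0"
proof -
  have sg: "subgroup A G" using A normal_imp_subgroup by blast
  have BA': "B \<lhd> G\<lparr>carrier := A\<rparr>" using normal_restrict_supergroup[OF sg B BA] .
  show "group (G\<lparr>carrier := A\<rparr> Mod B)" using normal.factorgroup_is_group[OF BA'] .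
  show "card A = order (G\<lparr>carrier := A\<rparr> Mod B) * card B"
    using group.lagrange[OF subgroup_imp_group[OF sg] normal_imp_subgroup[OF BA']]
    by (simp add: order_def FactGroup_def)
  show "card B > 0"
    using B fin normal_imp_subgroup subgroup.finite_imp_card_positive by blast
qed

text \<open>
  The condition that \<open>p\<close>-supersolvability puts on a chief factor of order \<open>a / b\<close>, as a relation
  between the two orders, so that it can be carried along homomorphisms by counting alone.
\<close>
definition supersolvable_ratio :: "nat \<Rightarrow> nat \<Rightarrow> nat \<Rightarrow> bool" where
  "supersolvable_ratio p a b \<longleftrightarrow> a = p * b \<or> \<not> p dvd a div b"

lemma supersolvable_ratio_cross:
  assumes "a * b' = b * a'" "b dvd a" "b > 0" "b' > 0"
  shows "supersolvable_ratio p a b \<longleftrightarrow> supersolvable_ratio p a' b'"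
proof -
  obtain q where q: "a = b * q" using assms(2) by auto
  then have "a' = q * b'" using assms(1,3) by simp
  then show ?thesis using q assms(3,4) by (auto simp: supersolvable_ratio_def)
qed

lemma (in group) p_supersolvable_iff:
  assumes "finite (carrier G)"
  shows "p_supersolvable p G \<longleftrightarrow>
    (\<forall>A B. chief_factor G A B \<longrightarrow> supersolvable_ratio p (card A) (card B))"
proof -
  have "order (G\<lparr>carrier := A\<rparr> Mod B) = p \<or> is_p'_group p (G\<lparr>carrier := A\<rparr> Mod B) \<longleftrightarrow>
      supersolvable_ratio p (card A) (card B)" if "chief_factor G A B" for A B
  proof -
    note n = chief_factor_normal[OF that]
    note s = order_section[OF assms n(1,2) psubset_imp_subset[OF n(3)]]
    show ?thesis using s(3) unfolding s(2) by (simp add: supersolvable_ratio_def is_p'_group_def s(1))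
  qed
  then show ?thesis unfolding p_supersolvable_def by blast
qed

lemma (in group) p_solvable_iff:
  assumes "finite (carrier G)"
  shows "p_solvable p G \<longleftrightarrow>
    (\<forall>A B. chief_factor G A B \<longrightarrow> (\<exists>n. card A = p ^ n * card B) \<or> \<not> p dvd card A div card B)"
proof -
  have "is_p_group p (G\<lparr>carrier := A\<rparr> Mod B) \<or> is_p'_group p (G\<lparr>carrier := A\<rparr> Mod B) \<longleftrightarrow>
      (\<exists>n. card A = p ^ n * card B) \<or> \<not> p dvd card A div card B" if "chief_factor G A B" for A B
  proof -
    note n = chief_factor_normal[OF that]
    note s = order_section[OF assms n(1,2) psubset_imp_subset[OF n(3)]]
    show ?thesis using s(3) unfolding s(2) by (simp add: is_p_group_def is_p'_group_def s(1))
  qed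
  then show ?thesis unfolding p_solvable_def by blast
qed

lemma (in group) card_subgroup_dvd:
  assumes "subgroup A G" "subgroup B G" "A \<subseteq> B"
  shows "card A dvd card B"
proof -
  have "card (rcosets\<^bsub>G\<lparr>carrier := B\<rparr>\<^esub> A) * card A = card B"
    using group.lagrange[OF subgroup_imp_group[OF assms(2)] subgroup_incl[OF assms]]
    by (simp add: order_def)
  then show ?thesis using dvd_triv_right by metis
qed

lemma (in group) chief_factor_ratio_cross:
  assumes "finite (carrier G)" "chief_factor G A B" "card A * b' = card B * a'" "b' > 0"
  shows "supersolvable_ratio p (card A) (card B) \<longleftrightarrow> supersolvable_ratio p a' b'"
proof -
  note n = chief_factor_normal[OF assms(2)]
  show ?thesis
    using supersolvable_ratio_cross[OF assms(3) _ _ assms(4)]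
      order_section(3)[OF assms(1) n(1,2) psubset_imp_subset[OF n(3)]]
      card_subgroup_dvd[OF n(2,1)[THEN normal_imp_subgroup] psubset_imp_subset[OF n(3)]]
    by blast
qed

context finite_epimorphism
begin

lemma card_pos: "subgroup A G \<Longrightarrow> card A > 0"
  using fin subgroup.finite_imp_card_positive by blast

lemma card_pos_image: "subgroup A H \<Longrightarrow> card A > 0"
  using finite_image subgroup.finite_imp_card_positive by blast

lemma image_ratio:
  assumes "chief_factor G A B" "h ` A \<noteq> h ` B"
  shows "supersolvable_ratio p (card A) (card B) \<longleftrightarrow> supersolvable_ratio p (card (h ` A)) (card (h ` B))"
  using G.chief_factor_ratio_cross[OF fin assms(1) chief_factor_image(2)[OF assms]]
    chief_factor_normal[OF assms(1)] normal_image card_pos_image normal_imp_subgroup by blast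

lemma kernel_ratio:
  assumes "chief_factor G A B" "h ` A = h ` B"
  shows "supersolvable_ratio p (card A) (card B) \<longleftrightarrow>
    supersolvable_ratio p (card (A \<inter> ker)) (card (B \<inter> ker))"
  using G.chief_factor_ratio_cross[OF fin assms(1) chief_factor_kernel(2)[OF assms]]
    chief_factor_normal[OF chief_factor_kernel(1)[OF assms]] card_pos normal_imp_subgroup by blast

text \<open>
  Chief factors of the image are those of \<open>G\<close> above the kernel. This turns \<open>p\<close>-supersolvability of
  quotients by different normal subgroups into conditions on the chief factors of the one group \<open>G\<close>.
\<close>
lemma p_supersolvable_image_iff:
  "p_supersolvable p H \<longleftrightarrow>
    (\<forall>A B. chief_factor G A B \<longrightarrow> ker \<subseteq> B \<longrightarrow> supersolvable_ratio p (card A) (card B))"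
    (is "?L \<longleftrightarrow> ?R")
proof
  assume L: ?L
  show ?R
  proof (intro allI impI)
    fix A B assume AB: "chief_factor G A B" and k: "ker \<subseteq> B"
    have "h ` A \<noteq> h ` B"
    proof
      assume eq: "h ` A = h ` B"
      show False
        using chief_factor_normal[OF chief_factor_kernel(1)[OF AB eq]] k chief_factor_normal(3)[OF AB]
        by blast
    qed
    then show "supersolvable_ratio p (card A) (card B)"
      using L image_ratio[OF AB] chief_factor_image(1)[OF AB] H.p_supersolvable_iff[OF finite_image]
      by blast
  qed
next
  assume R: ?R
  show ?L unfolding H.p_supersolvable_iff[OF finite_image]
  proof (intro allI impI)
    fix A B assume AB: "chief_factor H A B"
    note n = chief_factor_normal[OF AB]
    have sg: "subgroup A H" "subgroup B H" using n normal_imp_subgroup by blast+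
    have "supersolvable_ratio p (card (pre A)) (card (pre B))"
      using R chief_factor_pre[OF AB] ker_subset_pre[OF sg(2)] by blast
    then show "supersolvable_ratio p (card A) (card B)"
      using H.chief_factor_ratio_cross[OF finite_image AB card_pre_cross[OF sg]]
        card_pos subgroup_pre sg by blast
  qed
qed

lemma p_solvable_image:
  assumes "p_solvable p G" shows "p_solvable p H"
  unfolding H.p_solvable_iff[OF finite_image]
proof (intro allI impI)
  fix A B assume AB: "chief_factor H A B"
  note n = chief_factor_normal[OF AB]
  have sg: "subgroup A H" "subgroup B H" using n normal_imp_subgroup by blast+
  have k: "card ker > 0" using card_pos subgroup_kernel by blast
  have "(\<exists>n. card (pre A) = p ^ n * card (pre B)) \<or> \<not> p dvd card (pre A) div card (pre B)"
    using assms chief_factor_pre[OF AB] G.p_solvable_iff[OF fin] by blast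
  then show "(\<exists>n. card A = p ^ n * card B) \<or> \<not> p dvd card A div card B"
    using k by (auto simp: card_pre sg)
qed

lemma p_supersolvable_image:
  assumes "p_supersolvable p G" shows "p_supersolvable p H"
  using assms p_supersolvable_image_iff G.p_supersolvable_iff[OF fin] by blast

text \<open>
  A chief factor of \<open>G\<close> either maps to one of the image or is one inside the kernel, where its order
  is prime to \<open>p\<close>.
\<close>
lemma p_supersolvable_p'_kernel:
  assumes H: "p_supersolvable p H" and k: "\<not> p dvd card ker"
  shows "p_supersolvable p G"
  unfolding G.p_supersolvable_iff[OF fin]
proof (intro allI impI)
  fix A B assume AB: "chief_factor G A B"
  show "supersolvable_ratio p (card A) (card B)"
  proof (cases "h ` A = h ` B")
    case True
    note n = chief_factor_normal[OF chief_factor_kernel(1)[OF AB True]]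
    have "card (A \<inter> ker) dvd card ker"
      using n by (intro G.card_subgroup_dvd) (auto simp: normal_imp_subgroup subgroup_kernel)
    moreover have "card (B \<inter> ker) dvd card (A \<inter> ker)"
      using n by (intro G.card_subgroup_dvd) (auto simp: normal_imp_subgroup)
    then have "card (A \<inter> ker) div card (B \<inter> ker) dvd card (A \<inter> ker)"
      by (metis dvd_div_mult_self dvd_triv_left)
    ultimately have "\<not> p dvd card (A \<inter> ker) div card (B \<inter> ker)"
      using k dvd_trans by blast
    then show ?thesis
      using kernel_ratio[OF AB True] by (simp add: supersolvable_ratio_def)
  next
    case False
    then show ?thesis
      using H image_ratio[OF AB] chief_factor_image(1)[OF AB] H.p_supersolvable_iff[OF finite_image]
      by blast
  qed
qed

lemma restrict_epimorphism:
  assumes T: "subgroup T G"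
  shows "finite_epimorphism (G\<lparr>carrier := T\<rparr>) (H\<lparr>carrier := h ` T\<rparr>) h"
proof -
  have "group (G\<lparr>carrier := T\<rparr>)" "group (H\<lparr>carrier := h ` T\<rparr>)"
    using T subgroup_img_is_subgroup G.subgroup_imp_group H.subgroup_imp_group by blast+
  moreover have "h \<in> hom (G\<lparr>carrier := T\<rparr>) (H\<lparr>carrier := h ` T\<rparr>)"
    using subgroup.mem_carrier[OF T] by (auto simp: hom_def)
  ultimately show ?thesis
    using finite_subgroup[OF T]
    by (simp add: finite_epimorphism_def group_hom_def group_hom_axioms_def finite_epimorphism_axioms_def)
qed

end

lemma (in group) finite_epimorphism_Mod:
  assumes fin: "finite (carrier G)" and N: "N \<lhd> G"
  shows "finite_epimorphism G (G Mod N) (\<lambda>x. N #> x)" and "kernel G (G Mod N) (\<lambda>x. N #> x) = N"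
proof -
  show "finite_epimorphism G (G Mod N) (\<lambda>x. N #> x)"
    using normal.r_coset_hom_Mod[OF N] normal.factorgroup_is_group[OF N] fin
    by (simp add: finite_epimorphism_def group_hom_def group_hom_axioms_def
        finite_epimorphism_axioms_def carrier_FactGroup)
  show "kernel G (G Mod N) (\<lambda>x. N #> x) = N"
    using coset_join1[of N] coset_join2[of _ N] N[THEN normal_imp_subgroup] subgroup.mem_carrier subgroup.subset
    by (fastforce simp: kernel_def)
qed

lemma (in group) p_supersolvable_Mod_iff:
  assumes "finite (carrier G)" "N \<lhd> G"
  shows "p_supersolvable p (G Mod N) \<longleftrightarrow>
    (\<forall>A B. chief_factor G A B \<longrightarrow> N \<subseteq> B \<longrightarrow> supersolvable_ratio p (card A) (card B))"
  using finite_epimorphism.p_supersolvable_image_iff[OF finite_epimorphism_Mod(1)[OF assms]]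
  by (simp add: finite_epimorphism_Mod(2)[OF assms])

text \<open>
  A chief factor \<open>A/B\<close> above \<open>M \<inter> N\<close> that \<open>G/M\<close> does not see can be replaced by
  \<open>(A \<inter> M)/(B \<inter> M)\<close>, of the same order; this one is seen by \<open>G/N\<close> because it lies inside \<open>M\<close> and
  above \<open>M \<inter> N\<close>. The replacement is needed: a diagonal chief factor can vanish in both quotients.
\<close>
lemma (in group) p_supersolvable_Mod_Int:
  assumes fin: "finite (carrier G)" and M: "M \<lhd> G" and N: "N \<lhd> G"
    and UM: "p_supersolvable p (G Mod M)" and UN: "p_supersolvable p (G Mod N)"
  shows "p_supersolvable p (G Mod (M \<inter> N))"
  unfolding p_supersolvable_Mod_iff[OF fin normal_subgroup_intersect[OF M N]]
proof (intro allI impI)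
  interpret M: finite_epimorphism G "G Mod M" "\<lambda>x. M #> x"
    by (rule finite_epimorphism_Mod(1)[OF fin M])
  interpret N: finite_epimorphism G "G Mod N" "\<lambda>x. N #> x"
    by (rule finite_epimorphism_Mod(1)[OF fin N])
  have kM: "M.ker = M" and kN: "N.ker = N"
    using finite_epimorphism_Mod(2)[OF fin] M N by auto
  fix A B assume AB: "chief_factor G A B" and MN: "M \<inter> N \<subseteq> B"
  have imM: "supersolvable_ratio p (card A) (card B)"
    if "chief_factor G A B" "(\<lambda>x. M #> x) ` A \<noteq> (\<lambda>x. M #> x) ` B" for A B
    using M.image_ratio[OF that] M.chief_factor_image(1)[OF that] UM
      group.p_supersolvable_iff[OF M.H.is_group M.finite_image] by blast
  have imN: "supersolvable_ratio p (card A) (card B)"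
    if "chief_factor G A B" "(\<lambda>x. N #> x) ` A \<noteq> (\<lambda>x. N #> x) ` B" for A B
    using N.image_ratio[OF that] N.chief_factor_image(1)[OF that] UN
      group.p_supersolvable_iff[OF N.H.is_group N.finite_image] by blast
  show "supersolvable_ratio p (card A) (card B)"
  proof (cases "(\<lambda>x. M #> x) ` A = (\<lambda>x. M #> x) ` B")
    case True
    note ch = M.chief_factor_kernel(1)[OF AB True, unfolded kM]
    have "(\<lambda>x. N #> x) ` (A \<inter> M) \<noteq> (\<lambda>x. N #> x) ` (B \<inter> M)"
    proof
      assume eq: "(\<lambda>x. N #> x) ` (A \<inter> M) = (\<lambda>x. N #> x) ` (B \<inter> M)"
      show False
        using chief_factor_normal(3)[OF N.chief_factor_kernel(1)[OF ch eq]] MN kN by blast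
    qed
    then show ?thesis
      using imN[OF ch] M.kernel_ratio[OF AB True] kM by simp
  next
    case False
    then show ?thesis using imM[OF AB] by blast
  qed
qed

text \<open>
  The residual is an intersection of finitely many normal subgroups, so closure under binary
  intersections makes the quotient by it \<open>p\<close>-supersolvable.
\<close>
lemma (in group) supersolvable_residual_normal:
  assumes fin: "finite (carrier G)"
  shows "supersolvable_residual p G \<lhd> G"
    and "p_supersolvable p (G Mod supersolvable_residual p G)"
proof -
  let ?F = "{N. N \<lhd> G \<and> p_supersolvable p (G Mod N)}"
  have "p_supersolvable p (G Mod carrier G)"
    unfolding p_supersolvable_Mod_iff[OF fin normal_self]
    using chief_factor_normal normal_imp_subgroup subgroup.subset by (metis psubsetD subset_not_subset_eq subsetD subsetI)
  then have ne: "carrier G \<in> ?F" using normal_self by blast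
  have "?F \<subseteq> Pow (carrier G)" using normal_imp_subgroup subgroup.subset by blast
  then have finF: "finite ?F" using fin finite_subset by blast
  have "\<Inter>F \<in> ?F" if "F \<subseteq> ?F" "F \<noteq> {}" for F
    using finite_subset[OF that(1) finF] that(2,1)
  proof (induction rule: finite_ne_induct)
    case (insert N F)
    then show ?case
      using normal_subgroup_intersect p_supersolvable_Mod_Int[OF fin] by auto
  qed auto
  then have "\<Inter>?F \<in> ?F" using ne by blast
  then show "supersolvable_residual p G \<lhd> G"
    "p_supersolvable p (G Mod supersolvable_residual p G)"
    by (auto simp: supersolvable_residual_def)
qed

lemma supersolvable_residual_subset:
  assumes "N \<lhd> G" "p_supersolvable p (G Mod N)"
  shows "supersolvable_residual p G \<subseteq> N"
  using assms unfolding supersolvable_residual_def by blast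

lemma (in group) p_supersolvable_residual_trivial:
  assumes fin: "finite (carrier G)"
  shows "p_supersolvable p G \<longleftrightarrow> supersolvable_residual p G = {\<one>}"
proof
  have one: "\<And>A B. chief_factor G A B \<Longrightarrow> {\<one>} \<subseteq> B"
    using chief_factor_normal(2) normal_imp_subgroup subgroup.one_closed by blast
  have eq: "p_supersolvable p (G Mod {\<one>}) \<longleftrightarrow> p_supersolvable p G"
    using p_supersolvable_Mod_iff[OF fin one_is_normal] p_supersolvable_iff[OF fin] one by blast
  show "supersolvable_residual p G = {\<one>}" if "p_supersolvable p G"
    using supersolvable_residual_subset[OF one_is_normal, of p] that eq
      subgroup.one_closed[OF normal_imp_subgroup[OF supersolvable_residual_normal(1)[OF fin]], of p]
    by blast
  show "p_supersolvable p G" if "supersolvable_residual p G = {\<one>}"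
    using supersolvable_residual_normal(2)[OF fin, of p] that eq by simp
qed

text \<open>
  Both inclusions come from minimality of a residual: the image of the residual of \<open>G\<close> has
  \<open>p\<close>-supersolvable quotient in \<open>H\<close>, and the preimage of the residual of \<open>H\<close> has one in \<open>G\<close>.
\<close>
lemma (in finite_epimorphism) supersolvable_residual_image:
  "supersolvable_residual p H = h ` supersolvable_residual p G"
proof
  let ?R = "supersolvable_residual p G" and ?S = "supersolvable_residual p H"
  have R: "?R \<lhd> G" and UR: "p_supersolvable p (G Mod ?R)"
    using G.supersolvable_residual_normal[OF fin] by auto
  have S: "?S \<lhd> H" and US: "p_supersolvable p (H Mod ?S)"
    using H.supersolvable_residual_normal[OF finite_image] by auto
  have ratio: "supersolvable_ratio p (card A) (card B) \<longleftrightarrow>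
      supersolvable_ratio p (card (pre A)) (card (pre B))" if "chief_factor H A B" for A B
  proof -
    note n = chief_factor_normal[OF that]
    have sg: "subgroup A H" "subgroup B H" using n(1,2) by (auto dest: normal_imp_subgroup)
    show ?thesis
      by (rule H.chief_factor_ratio_cross[OF finite_image that card_pre_cross[OF sg]
            card_pos[OF subgroup_pre[OF sg(2)]]])
  qed
  have RG: "?R \<subseteq> carrier G" using subgroup.subset[OF normal_imp_subgroup[OF R]] .
  have "p_supersolvable p (H Mod h ` ?R)"
    unfolding H.p_supersolvable_Mod_iff[OF finite_image normal_image[OF R]]
  proof (intro allI impI)
    fix A B assume AB: "chief_factor H A B" and B: "h ` ?R \<subseteq> B"
    have "?R \<subseteq> pre B" using B RG by (auto simp: pre_def)
    then show "supersolvable_ratio p (card A) (card B)"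
      using UR chief_factor_pre[OF AB] ratio[OF AB] G.p_supersolvable_Mod_iff[OF fin R] by blast
  qed
  then show "?S \<subseteq> h ` ?R"
    by (rule supersolvable_residual_subset[OF normal_image[OF R]])
  have sS: "subgroup ?S H" using normal_imp_subgroup[OF S] .
  have "p_supersolvable p (G Mod pre ?S)"
    unfolding G.p_supersolvable_Mod_iff[OF fin normal_pre[OF S]]
  proof (intro allI impI)
    fix A B assume AB: "chief_factor G A B" and B: "pre ?S \<subseteq> B"
    have ne: "h ` A \<noteq> h ` B"
    proof
      assume "h ` A = h ` B"
      from chief_factor_normal(3)[OF chief_factor_kernel(1)[OF AB this]]
      show False using ker_subset_pre[OF sS] B chief_factor_normal(3)[OF AB] by blast
    qed
    have "?S \<subseteq> h ` B"
      using image_pre[OF subgroup.subset[OF sS]] B by blast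
    then show "supersolvable_ratio p (card A) (card B)"
      using US image_ratio[OF AB ne] chief_factor_image(1)[OF AB ne]
        H.p_supersolvable_Mod_iff[OF finite_image S] by blast
  qed
  then have "?R \<subseteq> pre ?S"
    by (rule supersolvable_residual_subset[OF normal_pre[OF S]])
  then show "h ` ?R \<subseteq> ?S" by (auto simp: pre_def)
qed

lemma (in group) mem_normalizer:
  assumes "S \<subseteq> carrier G"
  shows "g \<in> normalizer G S \<longleftrightarrow> g \<in> carrier G \<and> (\<lambda>x. g \<otimes> x \<otimes> inv g) ` S = S"
proof -
  have "g <# S #> inv g = (\<lambda>x. g \<otimes> x \<otimes> inv g) ` S"
    by (auto simp: l_coset_def r_coset_def)
  then show ?thesis using assms by (simp add: normalizer_def stabilizer_def)
qed

lemma (in group) normalizer_eq_carrier: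
  assumes S: "subgroup S G" shows "carrier G \<subseteq> normalizer G S \<longleftrightarrow> S \<lhd> G"
proof
  show "S \<lhd> G" if "carrier G \<subseteq> normalizer G S"
    using S that mem_normalizer[OF subgroup.subset[OF S]] by (intro normal_invI) blast+
  show "carrier G \<subseteq> normalizer G S" if N: "S \<lhd> G"
  proof
    fix g assume g: "g \<in> carrier G"
    have "x \<in> (\<lambda>x. g \<otimes> x \<otimes> inv g) ` S" if x: "x \<in> S" for x
    proof
      show "inv g \<otimes> x \<otimes> g \<in> S" using normal.inv_op_closed1[OF N g x] .
      show "x = g \<otimes> (inv g \<otimes> x \<otimes> g) \<otimes> inv g"
        using conjugation_is_surj[OF g subgroup.mem_carrier[OF S x]] by simp
    qed
    then show "g \<in> normalizer G S"
      unfolding mem_normalizer[OF subgroup.subset[OF S]]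
      using g normal.inv_op_closed2[OF N g] by blast
  qed
qed

lemma (in group) supersolvable_residual_subgroup:
  assumes fin: "finite (carrier G)" and T: "subgroup T G"
  shows "subgroup (supersolvable_residual p (G\<lparr>carrier := T\<rparr>)) G"
    and "supersolvable_residual p (G\<lparr>carrier := T\<rparr>) \<subseteq> T"
proof -
  have g: "group (G\<lparr>carrier := T\<rparr>)" and f: "finite (carrier (G\<lparr>carrier := T\<rparr>))"
    using subgroup_imp_group[OF T] finite_subset[OF subgroup.subset[OF T] fin] by auto
  have R: "subgroup (supersolvable_residual p (G\<lparr>carrier := T\<rparr>)) (G\<lparr>carrier := T\<rparr>)"
    using normal_imp_subgroup[OF group.supersolvable_residual_normal(1)[OF g f]] .
  show "subgroup (supersolvable_residual p (G\<lparr>carrier := T\<rparr>)) G" using incl_subgroup[OF T R] .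
  show "supersolvable_residual p (G\<lparr>carrier := T\<rparr>) \<subseteq> T" using subgroup.subset[OF R] by simp
qed

text \<open>
  The form in which the hypothesis on the norm is used.
\<close>
lemma (in group) norm_eq_carrier_iff:
  assumes fin: "finite (carrier G)"
  shows "carrier G = supersolvable_norm p G \<longleftrightarrow>
    (\<forall>T. subgroup T G \<longrightarrow> supersolvable_residual p (G\<lparr>carrier := T\<rparr>) \<lhd> G)" (is "_ \<longleftrightarrow> ?R")
proof -
  let ?r = "\<lambda>T. supersolvable_residual p (G\<lparr>carrier := T\<rparr>)"
  have le: "supersolvable_norm p G \<subseteq> carrier G"
    using subgroup_self mem_normalizer[OF subgroup.subset[OF supersolvable_residual_subgroup(1)[OF fin subgroup_self]]]
    unfolding supersolvable_norm_def by blast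
  have "carrier G \<subseteq> supersolvable_norm p G \<longleftrightarrow> (\<forall>T. subgroup T G \<longrightarrow> carrier G \<subseteq> normalizer G (?r T))"
    unfolding supersolvable_norm_def by blast
  also have "\<dots> \<longleftrightarrow> ?R"
    using normalizer_eq_carrier[OF supersolvable_residual_subgroup(1)[OF fin]] by blast
  finally show ?thesis using le by blast
qed

lemma (in finite_epimorphism) norm_eq_carrier_image:
  assumes "carrier G = supersolvable_norm p G"
  shows "carrier H = supersolvable_norm p H"
  unfolding H.norm_eq_carrier_iff[OF finite_image]
proof (intro allI impI)
  fix T assume T: "subgroup T H"
  have pT: "subgroup (pre T) G" using subgroup_pre[OF T] .
  have im: "h ` pre T = T" using image_pre[OF subgroup.subset[OF T]] .
  have n: "supersolvable_residual p (G\<lparr>carrier := pre T\<rparr>) \<lhd> G"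
    using assms pT unfolding G.norm_eq_carrier_iff[OF fin] by blast
  show "supersolvable_residual p (H\<lparr>carrier := T\<rparr>) \<lhd> H"
    using normal_image[OF n]
      finite_epimorphism.supersolvable_residual_image[OF restrict_epimorphism[OF pT], of p]
    unfolding im by simp
qed

section \<open>Sylow conjugacy and transfer\<close>

text \<open>
  Induction on the order passes to quotients, and the type of the elements must stay the same for
  that. Every quotient of a finite group is therefore copied onto natural numbers.
\<close>
lemma (in group) finite_epimorphism_nat:
  assumes fin: "finite (carrier G)" and N: "N \<lhd> G"
  obtains Q :: "nat monoid" and f where "finite_epimorphism G Q f" "kernel G Q f = N"
proof -
  interpret M: finite_epimorphism G "G Mod N" "\<lambda>x. N #> x"
    by (rule finite_epimorphism_Mod(1)[OF fin N])
  obtain e :: "'a set \<Rightarrow> nat" where e: "inj_on e (carrier (G Mod N))"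
    using finite_imp_inj_to_nat_seg[OF M.finite_image] by blast
  let ?Q = "image_group e (G Mod N)"
  have Q: "group ?Q" and iso: "e \<in> iso (G Mod N) ?Q"
    using M.H.inj_imp_image_group_is_group[OF e] inj_imp_image_group_iso[OF e] by auto
  have "(e \<circ> (\<lambda>x. N #> x)) \<in> hom G ?Q"
    using Group.hom_compose[OF M.homh, of e ?Q] iso by (simp add: iso_def)
  moreover have "(e \<circ> (\<lambda>x. N #> x)) ` carrier G = carrier ?Q"
    by (simp only: image_comp[symmetric] M.surj image_group_carrier)
  ultimately have ep: "finite_epimorphism G ?Q (e \<circ> (\<lambda>x. N #> x))"
    using Q fin by (simp add: finite_epimorphism_def group_hom_def group_hom_axioms_def
        finite_epimorphism_axioms_def)
  have "e (N #> x) = \<one>\<^bsub>?Q\<^esub> \<longleftrightarrow> N #> x = \<one>\<^bsub>G Mod N\<^esub>" if "x \<in> carrier G" for x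
    using inj_on_eq_iff[OF e] that M.H.one_closed M.hom_closed unfolding image_group_one by blast
  then have "kernel G ?Q (e \<circ> (\<lambda>x. N #> x)) = kernel G (G Mod N) (\<lambda>x. N #> x)"
    unfolding kernel_def by auto
  then show ?thesis using that[OF ep] finite_epimorphism_Mod(2)[OF fin N] by simp
qed

lemma (in group) group_action_restrict:
  assumes cl: "\<And>g x. g \<in> carrier G \<Longrightarrow> x \<in> E \<Longrightarrow> \<alpha> g x \<in> E"
    and one: "\<And>x. x \<in> E \<Longrightarrow> \<alpha> \<one> x = x"
    and mult: "\<And>g k x. g \<in> carrier G \<Longrightarrow> k \<in> carrier G \<Longrightarrow> x \<in> E \<Longrightarrow> \<alpha> (g \<otimes> k) x = \<alpha> g (\<alpha> k x)"
  shows "group_action G E (\<lambda>g. restrict (\<alpha> g) E)"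
proof -
  have bij: "restrict (\<alpha> g) E \<in> Bij E" if g: "g \<in> carrier G" for g
  proof -
    have "bij_betw (\<alpha> g) E E"
    proof (rule bij_betw_byWitness[where f' = "\<alpha> (inv g)"])
      show "\<forall>x\<in>E. \<alpha> (inv g) (\<alpha> g x) = x" "\<forall>x\<in>E. \<alpha> g (\<alpha> (inv g) x) = x"
        using g one mult[of "inv g" g] mult[of g "inv g"] by auto
      show "\<alpha> g ` E \<subseteq> E" "\<alpha> (inv g) ` E \<subseteq> E" using cl g by auto
    qed
    then show ?thesis by (simp add: Bij_def)
  qed
  have "(\<lambda>g. restrict (\<alpha> g) E) \<in> hom G (BijGroup E)"
  proof (rule homI)
    show "restrict (\<alpha> g) E \<in> carrier (BijGroup E)" if "g \<in> carrier G" for g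
      using bij[OF that] by (simp add: BijGroup_def)
    show "restrict (\<alpha> (g \<otimes> k)) E = restrict (\<alpha> g) E \<otimes>\<^bsub>BijGroup E\<^esub> restrict (\<alpha> k) E"
      if "g \<in> carrier G" "k \<in> carrier G" for g k
      using bij[OF that(1)] bij[OF that(2)] mult[OF that] cl[OF that(2)]
      by (auto simp: BijGroup_def compose_def restrict_def)
  qed
  then show ?thesis
    by (simp add: group_action_def group_hom_def group_hom_axioms_def is_group group_BijGroup)
qed

text \<open>
  The orbits have \<open>p\<close>-power length, so if none were a single point, \<open>p\<close> would divide \<open>card E\<close>.
\<close>
lemma (in group) p_group_fixed_point:
  assumes p: "Factorial_Ring.prime (p::nat)" and ord: "order G = p ^ a"
    and E: "finite E" "\<not> p dvd card E"
    and cl: "\<And>g x. g \<in> carrier G \<Longrightarrow> x \<in> E \<Longrightarrow> \<alpha> g x \<in> E"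
    and one: "\<And>x. x \<in> E \<Longrightarrow> \<alpha> \<one> x = x"
    and mult: "\<And>g k x. g \<in> carrier G \<Longrightarrow> k \<in> carrier G \<Longrightarrow> x \<in> E \<Longrightarrow> \<alpha> (g \<otimes> k) x = \<alpha> g (\<alpha> k x)"
  shows "\<exists>x\<in>E. \<forall>g\<in>carrier G. \<alpha> g x = x"
proof (rule ccontr)
  assume no: "\<not> ?thesis"
  let ?\<phi> = "\<lambda>g. restrict (\<alpha> g) E"
  interpret group_action G E ?\<phi> by (rule group_action_restrict[OF cl one mult])
  have "p dvd card Or" if Or: "Or \<in> orbits G E ?\<phi>" for Or
  proof -
    obtain x where x: "x \<in> E" and O: "Or = orbit G ?\<phi> x"
      using Or by (auto simp: orbits_def)
    have "card Or dvd p ^ a"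
      using orbit_stabilizer_theorem[OF x] O ord by (metis dvd_triv_left)
    then obtain i where i: "card Or = p ^ i"
      using p divides_primepow_nat by blast
    have "i \<noteq> 0"
    proof
      assume "i = 0"
      then have "card Or = 1" using i by simp
      then obtain y where y: "Or = {y}" by (rule card_1_singletonE)
      have "\<alpha> g x = x" if g: "g \<in> carrier G" for g
      proof -
        have "?\<phi> \<one> x \<in> Or" "?\<phi> g x \<in> Or" unfolding O orbit_def using g by blast+
        then show ?thesis using y x one by simp
      qed
      then show False using no x by blast
    qed
    then show ?thesis using i by simp
  qed
  then have "p dvd (\<Sum>C\<in>orbits G E ?\<phi>. card C)"
    by (intro dvd_sum)
  then show False using disjoint_sum[OF E(1), of "\<lambda>_. 1::nat"] E(2) by simp
qed

text \<open>
  The \<open>p\<close>-group \<open>Q\<close> acts by right translation on the cosets of \<open>P\<close>, whose number is prime to \<open>p\<close>; that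
  \<open>Q\<close> fixes a coset of \<open>P\<close> means that it lies in a conjugate of \<open>P\<close>.
\<close>
lemma (in group) sylow_conjugate:
  assumes p: "Factorial_Ring.prime (p::nat)" and fin: "finite (carrier G)"
    and P: "subgroup P G" and ind: "\<not> p dvd order G div card P"
    and Q: "subgroup Q G" and cQ: "card Q = p ^ a"
  obtains w where "w \<in> carrier G" "Q \<subseteq> (\<lambda>x. w \<otimes> x \<otimes> inv w) ` P"
proof -
  have PG: "P \<subseteq> carrier G" and QG: "Q \<subseteq> carrier G" using P Q subgroup.subset by auto
  have "card P > 0" using P fin subgroup.finite_imp_card_positive by blast
  then have E: "\<not> p dvd card (rcosets P)" using ind lagrange[OF P] by (metis div_mult_self_is_m)
  have "\<exists>C\<in>rcosets P. \<forall>g\<in>carrier (G\<lparr>carrier := Q\<rparr>). C #> inv g = C"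
  proof (rule group.p_group_fixed_point[OF subgroup_imp_group[OF Q] p])
    show "order (G\<lparr>carrier := Q\<rparr>) = p ^ a" using cQ by (simp add: order_def)
    show "finite (rcosets P)" using rcosets_subset_PowG[OF P] fin by (meson finite_Pow_iff finite_subset)
    show "\<not> p dvd card (rcosets P)" using E .
    fix C assume C: "C \<in> rcosets P"
    then obtain c where c: "c \<in> carrier G" "C = P #> c" by (auto simp: RCOSETS_def)
    show "C #> inv \<one>\<^bsub>G\<lparr>carrier := Q\<rparr>\<^esub> = C"
      using c PG r_coset_subset_G by (simp add: coset_mult_one)
    fix g assume "g \<in> carrier (G\<lparr>carrier := Q\<rparr>)"
    then have g: "g \<in> carrier G" using QG by auto
    show "C #> inv g \<in> rcosets P"
      using c g PG by (simp add: coset_mult_assoc rcosetsI)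
    fix k assume "k \<in> carrier (G\<lparr>carrier := Q\<rparr>)"
    then have k: "k \<in> carrier G" using QG by auto
    show "C #> inv (g \<otimes>\<^bsub>G\<lparr>carrier := Q\<rparr>\<^esub> k) = C #> inv k #> inv g"
      using c g k PG by (simp add: coset_mult_assoc inv_mult_group m_assoc)
  qed
  then obtain c where c: "c \<in> carrier G" and fix_c: "\<And>g. g \<in> Q \<Longrightarrow> P #> c #> inv g = P #> c"
    by (auto simp: RCOSETS_def)
  have "g \<in> (\<lambda>x. inv c \<otimes> x \<otimes> inv (inv c)) ` P" if g: "g \<in> Q" for g
  proof -
    have gG: "g \<in> carrier G" using g QG by auto
    have "inv g \<in> Q" using g Q subgroup.m_inv_closed by metis
    then have "P #> c #> g = P #> c" using fix_c[of "inv g"] gG by simp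
    then have "P #> (c \<otimes> g) = P #> c" using c gG PG by (simp add: coset_mult_assoc)
    then have "c \<otimes> g \<in> P #> c" using rcos_self[OF _ P, of "c \<otimes> g"] c gG by simp
    then obtain x where x: "x \<in> P" "c \<otimes> g = x \<otimes> c" by (auto simp: r_coset_def)
    have "g = inv c \<otimes> (c \<otimes> g)" using c gG by (simp add: m_assoc[symmetric])
    then have "g = inv c \<otimes> x \<otimes> inv (inv c)" using x c PG by (auto simp: m_assoc)
    then show ?thesis using x by blast
  qed
  then show ?thesis using that[of "inv c"] c by blast
qed

lemma (in group) sylow_conjugate_subgroup:
  assumes p: "Factorial_Ring.prime (p::nat)" and fin: "finite (carrier G)" and W: "subgroup W G"
    and P: "subgroup P G" "P \<subseteq> W" and ind: "\<not> p dvd card W div card P"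
    and Q: "subgroup Q G" "Q \<subseteq> W" and cQ: "card Q = p ^ a"
  obtains w where "w \<in> W" "Q \<subseteq> (\<lambda>x. w \<otimes> x \<otimes> inv w) ` P"
proof -
  have WG: "group (G\<lparr>carrier := W\<rparr>)" and "finite W"
    using subgroup_imp_group[OF W] finite_subset[OF subgroup.subset[OF W] fin] by auto
  then obtain w where "w \<in> W" "Q \<subseteq> (\<lambda>x. w \<otimes> x \<otimes> inv\<^bsub>G\<lparr>carrier := W\<rparr>\<^esub> w) ` P"
    using group.sylow_conjugate[OF WG p _ subgroup_incl[OF P(1) W P(2)] _ subgroup_incl[OF Q(1) W Q(2)] cQ]
      ind by (auto simp: order_def)
  then show ?thesis using that m_inv_consistent[OF W] by auto
qed

text \<open>
  The transfer into a central subgroup \<open>M\<close>. With a representative \<open>s C\<close> of each coset \<open>C\<close>, the elements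
  \<open>s C \<otimes> x \<otimes> inv (s (C #> x))\<close> lie in \<open>M\<close>; their product over all \<open>C\<close> is multiplicative in \<open>x\<close> because
  translation by \<open>x\<close> permutes the cosets. On \<open>M\<close> each of them equals \<open>x\<close>.
\<close>
lemma (in group) central_transfer:
  assumes fin: "finite (carrier G)" and M: "subgroup M G"
    and central: "\<And>m x. m \<in> M \<Longrightarrow> x \<in> carrier G \<Longrightarrow> m \<otimes> x = x \<otimes> m"
  obtains \<tau> where "\<tau> \<in> hom G (G\<lparr>carrier := M\<rparr>)" "\<And>m. m \<in> M \<Longrightarrow> \<tau> m = m [^] card (rcosets M)"
proof -
  have MG: "M \<subseteq> carrier G" using subgroup.subset[OF M] .
  have gM: "group (G\<lparr>carrier := M\<rparr>)" using subgroup_imp_group[OF M] .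
  interpret M: comm_group "G\<lparr>carrier := M\<rparr>"
    using gM central MG by (intro group.group_comm_groupI) auto
  define s where "s C = (SOME x. x \<in> C)" for C :: "'a set"
  define t where "t x C = s C \<otimes> x \<otimes> inv (s (C #> x))" for x C
  define \<tau> where "\<tau> x = finprod (G\<lparr>carrier := M\<rparr>) (t x) (rcosets M)" for x
  have s: "s C \<in> C" "s C \<in> carrier G" "C = M #> s C" if C: "C \<in> rcosets M" for C
  proof -
    obtain c where c: "c \<in> carrier G" "C = M #> c" using C by (auto simp: RCOSETS_def)
    have "c \<in> C" using c rcos_self[OF c(1) M] by simp
    then show 1: "s C \<in> C" unfolding s_def by (rule someI)
    then show 2: "s C \<in> carrier G" using c r_coset_subset_G[OF MG c(1)] by blast
    show "C = M #> s C" using 1 c repr_independence[OF _ c(1) M] by simp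
  qed
  have tr: "C #> x \<in> rcosets M" if "C \<in> rcosets M" "x \<in> carrier G" for C x
    using that MG by (auto simp: RCOSETS_def coset_mult_assoc)
  have tM: "t x C \<in> M" if C: "C \<in> rcosets M" and x: "x \<in> carrier G" for C x
  proof -
    have "C #> x = M #> (s C \<otimes> x)"
      using arg_cong[OF s(3)[OF C], of "\<lambda>D. D #> x"] coset_mult_assoc[OF MG s(2)[OF C] x] by (rule trans)
    then have "s (C #> x) \<in> M #> (s C \<otimes> x)"
      using s(1)[OF tr[OF C x]] by simp
    then obtain m where m: "m \<in> M" "s (C #> x) = m \<otimes> (s C \<otimes> x)" by (auto simp: r_coset_def)
    have mG: "m \<in> carrier G" using m MG by auto
    have "t x C = (s C \<otimes> x) \<otimes> inv (s C \<otimes> x) \<otimes> inv m"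
      using s(2)[OF C] x mG by (simp add: t_def m inv_mult_group m_assoc)
    also have "\<dots> = inv m" using s(2)[OF C] x mG by simp
    finally show ?thesis using m M subgroup.m_inv_closed by metis
  qed
  have shift: "finprod (G\<lparr>carrier := M\<rparr>) (\<lambda>C. t y (C #> x)) (rcosets M) = \<tau> y"
    if x: "x \<in> carrier G" and y: "y \<in> carrier G" for x y
  proof -
    have bij: "bij_betw (\<lambda>C. C #> x) (rcosets M) (rcosets M)"
    proof (rule bij_betw_byWitness[where f' = "\<lambda>C. C #> inv x"])
      show "\<forall>C\<in>rcosets M. C #> x #> inv x = C" "\<forall>C\<in>rcosets M. C #> inv x #> x = C"
        using x MG by (auto simp: RCOSETS_def coset_mult_assoc m_assoc)
    qed (use tr x in auto)
    have "finprod (G\<lparr>carrier := M\<rparr>) (t y) ((\<lambda>C. C #> x) ` (rcosets M)) =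
        finprod (G\<lparr>carrier := M\<rparr>) (\<lambda>C. t y (C #> x)) (rcosets M)"
      using bij tM[OF _ y] unfolding bij_betw_def by (intro M.finprod_reindex) auto
    then show ?thesis using bij by (simp add: \<tau>_def bij_betw_def)
  qed
  have "\<tau> \<in> hom G (G\<lparr>carrier := M\<rparr>)"
  proof (rule homI)
    show "\<tau> x \<in> carrier (G\<lparr>carrier := M\<rparr>)" if "x \<in> carrier G" for x
      unfolding \<tau>_def using tM[OF _ that] by (intro M.finprod_closed) auto
    fix x y assume x: "x \<in> carrier G" and y: "y \<in> carrier G"
    have "\<tau> (x \<otimes> y) = finprod (G\<lparr>carrier := M\<rparr>) (\<lambda>C. t x C \<otimes> t y (C #> x)) (rcosets M)"
      unfolding \<tau>_def
    proof (rule M.finprod_cong')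
      show "(\<lambda>C. t x C \<otimes> t y (C #> x)) \<in> rcosets M \<rightarrow> carrier (G\<lparr>carrier := M\<rparr>)"
        using tM[OF _ x] tM[OF tr[OF _ x] y] subgroup.m_closed[OF M] by auto
      fix C assume C: "C \<in> rcosets M"
      have CG: "C \<subseteq> carrier G" using s(3)[OF C] r_coset_subset_G[OF MG s(2)[OF C]] by simp
      have "C #> (x \<otimes> y) = C #> x #> y" using CG x y by (simp add: coset_mult_assoc)
      then show "t (x \<otimes> y) C = t x C \<otimes> t y (C #> x)"
        using s(2)[OF C] s(2)[OF tr[OF C x]] s(2)[OF tr[OF tr[OF C x] y]] x y
        by (simp add: t_def m_assoc inv_solve_left)
    qed simp
    also have "\<dots> = \<tau> x \<otimes>\<^bsub>G\<lparr>carrier := M\<rparr>\<^esub> finprod (G\<lparr>carrier := M\<rparr>) (\<lambda>C. t y (C #> x)) (rcosets M)"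
      unfolding \<tau>_def using M.finprod_multf[of "t x" "rcosets M" "\<lambda>C. t y (C #> x)"] tM[OF _ x] tM[OF tr[OF _ x] y]
      by auto
    finally show "\<tau> (x \<otimes> y) = \<tau> x \<otimes>\<^bsub>G\<lparr>carrier := M\<rparr>\<^esub> \<tau> y" using shift[OF x y] by simp
  qed
  moreover have "\<tau> m = m [^] card (rcosets M)" if m: "m \<in> M" for m
  proof -
    have mG: "m \<in> carrier G" using m MG by auto
    have "t m C = m" if C: "C \<in> rcosets M" for C
    proof -
      have "C #> m = M #> (m \<otimes> s C)"
        using s(2,3)[OF C] mG MG central[OF m s(2)[OF C]] by (metis coset_mult_assoc)
      also have "\<dots> = C" using s(2,3)[OF C] mG MG m coset_join2[OF mG M m] by (metis coset_mult_assoc)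
      finally show ?thesis
        using s(2)[OF C] mG central[OF m s(2)[OF C]] by (simp add: t_def m_assoc flip: central[OF m s(2)[OF C]])
    qed
    then have "\<tau> m = finprod (G\<lparr>carrier := M\<rparr>) (\<lambda>C. m) (rcosets M)"
      unfolding \<tau>_def using m by (intro M.finprod_cong') auto
    also have "\<dots> = m [^]\<^bsub>G\<lparr>carrier := M\<rparr>\<^esub> card (rcosets M)"
      using m by (intro M.finprod_const) auto
    also have "\<dots> = m [^] card (rcosets M)" by (simp add: nat_pow_consistent[symmetric])
    finally show ?thesis .
  qed
  ultimately show ?thesis using that by blast
qed

text \<open>
  The transfer restricted to \<open>M\<close> is the \<open>n\<close>-th power map, injective because \<open>n\<close> is prime to \<open>card M\<close>; so
  its kernel has order \<open>n\<close>. Naming the kernel as the set of solutions of \<open>x [^] n = \<one>\<close> makes visible that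
  it is invariant under every automorphism.
\<close>
lemma (in group) central_coprime_complement:
  assumes fin: "finite (carrier G)" and M: "subgroup M G"
    and central: "\<And>m x. m \<in> M \<Longrightarrow> x \<in> carrier G \<Longrightarrow> m \<otimes> x = x \<otimes> m"
    and ord: "order G = n * card M" and cop: "coprime n (card M)"
  shows "{x \<in> carrier G. x [^] n = \<one>} \<lhd> G" and "card {x \<in> carrier G. x [^] n = \<one>} = n"
proof -
  have gM: "group (G\<lparr>carrier := M\<rparr>)" using subgroup_imp_group[OF M] .
  have MG: "M \<subseteq> carrier G" using subgroup.subset[OF M] .
  have cM: "card M > 0" using M fin subgroup.finite_imp_card_positive by blast
  then have n: "card (rcosets M) = n" using lagrange[OF M] ord by simp
  obtain \<tau> where \<tau>: "\<tau> \<in> hom G (G\<lparr>carrier := M\<rparr>)" "\<And>m. m \<in> M \<Longrightarrow> \<tau> m = m [^] n"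
    using central_transfer[OF fin M central] n by metis
  have torsion: "m = \<one>" if m: "m \<in> M" "m [^] n = \<one>" for m
  proof -
    have mG: "m \<in> carrier G" using m MG by auto
    have "ord m dvd n" using pow_eq_id[OF mG] m(2) by simp
    moreover have "m [^] card M = \<one>"
      using group.pow_order_eq_1[OF gM, of m] m(1) by (simp add: order_def nat_pow_consistent[symmetric])
    then have "ord m dvd card M" using pow_eq_id[OF mG] by simp
    ultimately have "ord m = 1" using cop by (meson coprime_common_divisor_nat nat_dvd_1_iff_1 coprime_common_divisor)
    then show ?thesis using mG ord_eq_1 by simp
  qed
  have "inj_on \<tau> M"
  proof (rule inj_onI)
    fix a b assume a: "a \<in> M" and b: "b \<in> M" and eq: "\<tau> a = \<tau> b"
    have G: "a \<in> carrier G" "b \<in> carrier G" using a b MG by auto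
    have ab: "a \<otimes> inv b \<in> M" using a b M subgroup.m_closed subgroup.m_inv_closed by metis
    have "(a \<otimes> inv b) [^] n \<otimes> b [^] n = a [^] n"
      using pow_mult_distrib[of "a \<otimes> inv b" b n] central[OF ab G(2)] G by (simp add: m_assoc)
    then have "(a \<otimes> inv b) [^] n = \<one>"
      using eq \<tau>(2)[OF a] \<tau>(2)[OF b] G by (metis inv_closed m_closed nat_pow_closed r_cancel_one)
    then have "a \<otimes> inv b = \<one>" using torsion[OF ab] by simp
    then show "a = b" using G by (metis inv_inv inv_closed inv_equality)
  qed
  then have "\<tau> ` M = M"
    using hom_in_carrier[OF \<tau>(1)] MG finite_subset[OF MG fin]
    by (intro card_subset_eq) (auto simp: card_image)
  then have "\<tau> ` carrier G = M"
    using hom_carrier[OF \<tau>(1)] image_mono[OF MG, of \<tau>] by auto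
  then interpret T: finite_epimorphism G "G\<lparr>carrier := M\<rparr>" \<tau>
    using \<tau>(1) gM fin is_group by (simp add: finite_epimorphism_def group_hom_def group_hom_axioms_def
        finite_epimorphism_axioms_def)
  have ck: "card T.ker = n"
    using T.order_image ord cM by (simp add: order_def)
  have "T.ker = {x \<in> carrier G. x [^] n = \<one>}"
  proof (intro equalityI subsetI)
    fix x assume x: "x \<in> T.ker"
    have "x [^]\<^bsub>G\<lparr>carrier := T.ker\<rparr>\<^esub> n = \<one>"
      using group.pow_order_eq_1[OF subgroup_imp_group[OF T.subgroup_kernel], of x] x ck by (simp add: order_def)
    then show "x \<in> {x \<in> carrier G. x [^] n = \<one>}"
      using x by (simp add: nat_pow_consistent[symmetric] T.mem_ker)
  next
    fix x assume "x \<in> {x \<in> carrier G. x [^] n = \<one>}"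
    then have x: "x \<in> carrier G" "x [^] n = \<one>" by auto
    have "\<tau> x [^] n = \<one>"
      using T.hom_nat_pow[OF x(1), of n] x(2) T.hom_one by (simp add: nat_pow_consistent[symmetric])
    then show "x \<in> T.ker" using torsion[of "\<tau> x"] T.hom_closed[OF x(1)] x by (simp add: T.mem_ker)
  qed
  then show "{x \<in> carrier G. x [^] n = \<one>} \<lhd> G" "card {x \<in> carrier G. x [^] n = \<one>} = n"
    using T.normal_kernel ck by auto
qed

section \<open>The residual is a \<open>p\<close>-group\<close>

lemma (in group) conjugation_hom:
  assumes g: "g \<in> carrier G"
  shows "group_hom G G (\<lambda>x. g \<otimes> x \<otimes> inv g)"
proof -
  have "(\<lambda>x. g \<otimes> x \<otimes> inv g) \<in> hom G G"
    using g by (auto simp: hom_def m_assoc inv_solve_left)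
  then show ?thesis by (simp add: group_hom_def group_hom_axioms_def is_group)
qed

lemma (in group) conjugate_subgroup:
  assumes g: "g \<in> carrier G" and P: "subgroup P G"
  shows "subgroup ((\<lambda>x. g \<otimes> x \<otimes> inv g) ` P) G" and "card ((\<lambda>x. g \<otimes> x \<otimes> inv g) ` P) = card P"
proof -
  show "subgroup ((\<lambda>x. g \<otimes> x \<otimes> inv g) ` P) G"
    using group_hom.subgroup_img_is_subgroup[OF conjugation_hom[OF g] P] .
  have "inj_on (\<lambda>x. g \<otimes> x \<otimes> inv g) P"
    using g subgroup.mem_carrier[OF P] by (auto simp: inj_on_def)
  then show "card ((\<lambda>x. g \<otimes> x \<otimes> inv g) ` P) = card P" by (rule card_image)
qed

lemma (in group) conjugate_subset_normalizer:
  assumes fin: "finite (carrier G)" and g: "g \<in> carrier G" and P: "subgroup P G"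
    and sub: "(\<lambda>x. g \<otimes> x \<otimes> inv g) ` P \<subseteq> P"
  shows "g \<in> normalizer G P"
proof -
  have "finite P" using fin P subgroup.subset finite_subset by metis
  then have "(\<lambda>x. g \<otimes> x \<otimes> inv g) ` P = P"
    using card_subset_eq[OF _ sub] conjugate_subgroup(2)[OF g P] by simp
  then show ?thesis using g mem_normalizer[OF subgroup.subset[OF P]] by simp
qed

lemma coprime_prime_power:
  assumes "Factorial_Ring.prime (p::nat)" "\<not> p dvd k"
  shows "coprime (p ^ m) k"
  using assms by (simp add: prime_imp_coprime)

text \<open>
  The Frattini argument in the quotient: for \<open>g\<close> in \<open>G\<close>, the conjugate of \<open>P\<close> by \<open>g\<close> is conjugate to \<open>P\<close>
  by some \<open>w\<close> in \<open>pre R\<close>, so \<open>inv w \<otimes> g\<close> normalizes \<open>P\<close>; and \<open>h w\<close> lies in \<open>R\<close>, the image of \<open>P\<close>, hence comes from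
  the normalizer as well.
\<close>
lemma (in finite_epimorphism) frattini:
  assumes p: "Factorial_Ring.prime (p::nat)" and k: "\<not> p dvd card ker"
    and R: "R \<lhd> H" "card R = p ^ m" and P: "subgroup P G" "P \<subseteq> pre R" "card P = p ^ m"
  shows "h ` normalizer G P = carrier H"
proof
  let ?T = "normalizer G P"
  have PG: "P \<subseteq> carrier G" using subgroup.subset[OF P(1)] .
  have sT: "subgroup ?T G" using G.normalizer_imp_subgroup[OF PG] .
  show "h ` ?T \<subseteq> carrier H" using subgroup.subset[OF sT] by auto
  have L: "pre R \<lhd> G" "subgroup (pre R) G"
    using normal_pre[OF R(1)] normal_imp_subgroup by auto
  have cL: "card (pre R) = p ^ m * card ker"
    using card_pre[OF normal_imp_subgroup[OF R(1)]] R(2) by simp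
  have ind: "\<not> p dvd card (pre R) div card P"
    using k cL P(3) p by (simp add: prime_gt_0_nat)
  have PT: "P \<subseteq> ?T"
  proof
    fix x assume x: "x \<in> P"
    then show "x \<in> ?T" using subgroup.m_closed[OF P(1)] subgroup.m_inv_closed[OF P(1)] PG
      by (intro G.conjugate_subset_normalizer[OF fin _ P(1)]) auto
  qed
  \<comment> \<open>\<open>P\<close> meets the kernel trivially, as their orders are coprime.\<close>
  have hP: "h ` P = R"
  proof (rule card_subset_eq)
    show "finite R" using finite_image subgroup.subset[OF normal_imp_subgroup[OF R(1)]] finite_subset by blast
    show "h ` P \<subseteq> R" using P(2) by (auto simp: pre_def)
    have "subgroup (P \<inter> ker) G" using P(1) subgroup_kernel G.subgroups_Inter_pair by blast
    then have "card (P \<inter> ker) dvd p ^ m" "card (P \<inter> ker) dvd card ker"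
      using G.card_subgroup_dvd[of "P \<inter> ker" P] G.card_subgroup_dvd[of "P \<inter> ker" ker] P subgroup_kernel
      by auto
    then have "card (P \<inter> ker) = 1"
      using coprime_prime_power[OF p k, of m] by (metis coprime_common_divisor_nat nat_dvd_1_iff_1)
    then show "card (h ` P) = card R" using card_image_ker[OF P(1)] P(3) R(2) by simp
  qed
  show "carrier H \<subseteq> h ` ?T"
  proof
    fix y assume "y \<in> carrier H"
    then obtain g where g: "g \<in> carrier G" "y = h g" using surj by auto
    let ?Q = "(\<lambda>x. g \<otimes> x \<otimes> inv g) ` P"
    have QL: "?Q \<subseteq> pre R" using G.normal_invE(2)[OF L(1) g(1)] P(2) by auto
    have cQ: "card ?Q = p ^ m" using G.conjugate_subgroup(2)[OF g(1) P(1)] P(3) by simp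
    obtain w where w: "w \<in> pre R" "?Q \<subseteq> (\<lambda>x. w \<otimes> x \<otimes> inv w) ` P"
      using G.sylow_conjugate_subgroup[OF p fin L(2) P(1,2) ind G.conjugate_subgroup(1)[OF g(1) P(1)] QL cQ] .
    have wG: "w \<in> carrier G" using w(1) by (auto simp: pre_def)
    have n: "inv w \<otimes> g \<in> ?T"
    proof (rule G.conjugate_subset_normalizer[OF fin _ P(1)])
      show "inv w \<otimes> g \<in> carrier G" using g wG by simp
      show "(\<lambda>x. (inv w \<otimes> g) \<otimes> x \<otimes> inv (inv w \<otimes> g)) ` P \<subseteq> P"
      proof clarify
        fix x assume x: "x \<in> P"
        then have xG: "x \<in> carrier G" using PG by auto
        obtain z where z: "z \<in> P" "g \<otimes> x \<otimes> inv g = w \<otimes> z \<otimes> inv w" using w(2) x by auto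
        have zG: "z \<in> carrier G" using z PG by auto
        have "(inv w \<otimes> g) \<otimes> x \<otimes> inv (inv w \<otimes> g) = inv w \<otimes> (g \<otimes> x \<otimes> inv g) \<otimes> w"
          using g(1) wG xG by (simp add: G.inv_mult_group G.m_assoc)
        also have "\<dots> = z" unfolding z(2) using wG zG by (simp add: G.m_assoc G.inv_solve_left')
        finally show "(inv w \<otimes> g) \<otimes> x \<otimes> inv (inv w \<otimes> g) \<in> P" using z by simp
      qed
    qed
    have "h w \<in> h ` P" using w hP by (auto simp: pre_def)
    then obtain x where x: "x \<in> P" "h w = h x" by auto
    have xG: "x \<in> carrier G" using x PG by auto
    have "h (x \<otimes> (inv w \<otimes> g)) = h (w \<otimes> (inv w \<otimes> g))"
      using x(2) xG g(1) wG by (simp del: hom_inv)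
    also have "w \<otimes> (inv w \<otimes> g) = g" using g(1) wG by (simp add: G.m_assoc[symmetric])
    finally have "h (x \<otimes> (inv w \<otimes> g)) = y" using g by simp
    moreover have "x \<otimes> (inv w \<otimes> g) \<in> ?T" using subgroup.m_closed[OF sT _ n] PT x by auto
    ultimately show "y \<in> h ` ?T" by blast
  qed
qed

lemma (in group) sylow_subgroup_exists:
  assumes p: "Factorial_Ring.prime (p::nat)" and fin: "finite (carrier G)" and S: "subgroup S G"
    and cS: "card S = p ^ m * k"
  obtains P where "subgroup P G" "P \<subseteq> S" "card P = p ^ m"
proof -
  have "finite S" using fin S subgroup.subset finite_subset by metis
  then obtain P where P: "subgroup P (G\<lparr>carrier := S\<rparr>)" "card P = p ^ m"
    using Sylow.sylow_thm[OF p subgroup_imp_group[OF S], of m k] cS by (auto simp: order_def)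
  then show ?thesis using that incl_subgroup[OF S P(1)] subgroup.subset[OF P(1)] by auto
qed

text \<open>
  The heart of the first claim. Let \<open>P\<close> be a Sylow \<open>p\<close>-subgroup of the preimage \<open>L\<close> of the residual of
  \<open>H\<close>, and let \<open>S\<close> be the residual of \<open>T = N(P)\<close>. By the Frattini argument \<open>T\<close> maps onto \<open>H\<close>, so \<open>S\<close> maps
  onto the residual of \<open>H\<close>; hence \<open>S\<close> lies in \<open>W = T \<inter> L\<close> and its order is divisible by the order of
  \<open>P\<close>. In \<open>W\<close> the subgroup \<open>P\<close> is normal, so it is the only subgroup of its order: it lies in \<open>S\<close>, and
  since \<open>S\<close> is normal in \<open>G\<close>, every conjugate of \<open>P\<close> stays in \<open>W\<close> and equals \<open>P\<close>.
\<close>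
lemma (in finite_epimorphism) normal_sylow_of_residual:
  assumes p: "Factorial_Ring.prime (p::nat)" and k: "\<not> p dvd card ker"
    and norm: "carrier G = supersolvable_norm p G"
    and res: "card (supersolvable_residual p H) = p ^ m"
  shows "\<exists>P. P \<lhd> G \<and> card P = p ^ m"
proof -
  let ?R = "supersolvable_residual p H"
  have R: "?R \<lhd> H" using H.supersolvable_residual_normal[OF finite_image] by simp
  let ?L = "pre ?R"
  have L: "?L \<lhd> G" "subgroup ?L G" using normal_pre[OF R] normal_imp_subgroup by auto
  have cL: "card ?L = p ^ m * card ker" using card_pre[OF normal_imp_subgroup[OF R]] res by simp
  obtain P where P: "subgroup P G" "P \<subseteq> ?L" "card P = p ^ m"
    using G.sylow_subgroup_exists[OF p fin L(2) cL] .
  have PG: "P \<subseteq> carrier G" using subgroup.subset[OF P(1)] .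
  have finP: "finite P" using finite_subgroup[OF P(1)] .
  let ?T = "normalizer G P"
  have sT: "subgroup ?T G" using G.normalizer_imp_subgroup[OF PG] .
  have hT: "h ` ?T = carrier H" using frattini[OF p k R res P] .
  have PT: "P \<subseteq> ?T"
  proof
    fix x assume x: "x \<in> P"
    then show "x \<in> ?T" using subgroup.m_closed[OF P(1)] subgroup.m_inv_closed[OF P(1)] PG
      by (intro G.conjugate_subset_normalizer[OF fin _ P(1)]) auto
  qed
  let ?S = "supersolvable_residual p (G\<lparr>carrier := ?T\<rparr>)"
  have S: "?S \<lhd> G" using norm sT unfolding G.norm_eq_carrier_iff[OF fin] by blast
  have sS: "subgroup ?S G" and ST: "?S \<subseteq> ?T" using G.supersolvable_residual_subgroup[OF fin sT] by auto
  have hS: "h ` ?S = ?R"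
    using finite_epimorphism.supersolvable_residual_image[OF restrict_epimorphism[OF sT], of p] hT by simp
  have SL: "?S \<subseteq> ?L" using hS subgroup.subset[OF sS] by (auto simp: pre_def)
  let ?W = "?T \<inter> ?L"
  have W: "subgroup ?W G" using sT L(2) G.subgroups_Inter_pair by blast
  have PW: "P \<subseteq> ?W" using PT P(2) by auto
  have indW: "\<not> p dvd card ?W div card P"
  proof -
    obtain c where c: "card ?W = card P * c" using G.card_subgroup_dvd[OF P(1) W PW] by auto
    have "card ?W dvd card ?L" using G.card_subgroup_dvd[OF W L(2)] by auto
    then have "c dvd card ker" using c cL P(3) p by (simp add: prime_gt_0_nat)
    then show ?thesis using c k P(3) p by (auto simp: prime_gt_0_nat dest: dvd_trans)
  qed
  \<comment> \<open>Conjugation inside \<open>W\<close> leaves \<open>P\<close> fixed, so Sylow's theorem in \<open>W\<close> gives uniqueness.\<close>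
  have unique: "Q \<subseteq> P" if Q: "subgroup Q G" "Q \<subseteq> ?W" "card Q = p ^ m" for Q
  proof -
    obtain w where "w \<in> ?W" "Q \<subseteq> (\<lambda>x. w \<otimes> x \<otimes> inv w) ` P"
      using G.sylow_conjugate_subgroup[OF p fin W P(1) PW indW Q] .
    then show ?thesis using G.mem_normalizer[OF PG] by auto
  qed
  have "card ?S = p ^ m * card (?S \<inter> ker)" using card_image_ker[OF sS] hS res by simp
  then obtain Q where Q: "subgroup Q G" "Q \<subseteq> ?S" "card Q = p ^ m"
    using G.sylow_subgroup_exists[OF p fin sS] by metis
  have "Q \<subseteq> P" using unique[OF Q(1) _ Q(3)] Q(2) ST SL by auto
  then have "Q = P" using card_subset_eq[OF finP] Q(3) P(3) by simp
  then have PS: "P \<subseteq> ?S" using Q by simp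
  have "P \<lhd> G"
  proof (rule G.normal_invI[OF P(1)])
    fix g x assume g: "g \<in> carrier G" and x: "x \<in> P"
    have "(\<lambda>x. g \<otimes> x \<otimes> inv g) ` P \<subseteq> ?S"
      using G.normal_invE(2)[OF S g] PS by auto
    then have "(\<lambda>x. g \<otimes> x \<otimes> inv g) ` P \<subseteq> P"
      using unique[OF G.conjugate_subgroup(1)[OF g P(1)]] G.conjugate_subgroup(2)[OF g P(1)] P(3) ST SL by auto
    then show "g \<otimes> x \<otimes> inv g \<in> P" using x by auto
  qed
  then show ?thesis using P(3) by blast
qed

lemma (in finite_epimorphism) residual_p_group_lift:
  assumes p: "Factorial_Ring.prime (p::nat)" and k: "card ker = p ^ a"
    and res: "card (supersolvable_residual p H) = p ^ b"
  shows "\<exists>n. card (supersolvable_residual p G) = p ^ n"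
proof -
  let ?R = "supersolvable_residual p G"
  have R: "subgroup ?R G" using G.supersolvable_residual_normal(1)[OF fin] by (rule normal_imp_subgroup)
  have "subgroup (?R \<inter> ker) G" using R subgroup_kernel G.subgroups_Inter_pair by blast
  then have "card (?R \<inter> ker) dvd p ^ a" using G.card_subgroup_dvd[OF _ subgroup_kernel, of "?R \<inter> ker"] k by auto
  then obtain c where "card (?R \<inter> ker) = p ^ c" using p divides_primepow_nat by blast
  then have "card ?R = p ^ (b + c)"
    using card_image_ker[OF R] res by (simp add: supersolvable_residual_image power_add)
  then show ?thesis by blast
qed

lemma (in group) minimal_normal_exists:
  assumes fin: "finite (carrier G)" and N: "N \<lhd> G" "N \<noteq> {\<one>}"
  obtains M where "chief_factor G M {\<one>}"
proof -
  let ?F = "{N. N \<lhd> G \<and> N \<noteq> {\<one>}}"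
  have "?F \<subseteq> Pow (carrier G)" using normal_imp_subgroup subgroup.subset by blast
  then have "finite ?F" using fin finite_subset by blast
  moreover have "?F \<noteq> {}" using N by blast
  ultimately obtain M where M: "M \<in> ?F" "\<And>L. L \<in> ?F \<Longrightarrow> L \<subseteq> M \<Longrightarrow> M = L"
    using finite_has_minimal[of ?F] by blast
  have "\<one> \<in> M" using M(1) by (simp add: normal_imp_subgroup subgroup.one_closed)
  then have "chief_factor G M {\<one>}"
    using M one_is_normal by (intro chief_factorI) blast+
  then show ?thesis using that by blast
qed

lemma (in finite_epimorphism) order_image_less:
  assumes "ker \<noteq> {\<one>}" shows "order H < order G"
proof -
  have N: "finite ker" "\<one> \<in> ker"
    using finite_subgroup[OF subgroup_kernel] subgroup.one_closed[OF subgroup_kernel] by auto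
  have "card ker \<noteq> 1" using N(2) assms by (auto simp: card_1_singleton_iff)
  then have "card ker > 1" using N card_gt_0_iff[of ker] by auto
  moreover have "order H > 0" using H.order_gt_0_iff_finite finite_image by simp
  ultimately show ?thesis using n_less_m_mult_n[of "order H" "card ker"] order_image by (simp add: mult.commute)
qed

text \<open>
  A nontrivial normal \<open>p\<close>-subgroup is factored out by induction. Without one, a minimal normal subgroup
  is a \<open>p'\<close>-group, and \<open>normal_sylow_of_residual\<close> produces a normal \<open>p\<close>-subgroup after all, trivial only
  if the residual of the quotient is trivial, that is, if \<open>G\<close> is already \<open>p\<close>-supersolvable.
\<close>
lemma residual_p_group_nat:
  fixes G :: "nat monoid"
  assumes p: "Factorial_Ring.prime (p::nat)"
  shows "group G \<Longrightarrow> finite (carrier G) \<Longrightarrow> p_solvable p G \<Longrightarrow> carrier G = supersolvable_norm p G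
    \<Longrightarrow> \<exists>n. card (supersolvable_residual p G) = p ^ n"
proof (induction "order G" arbitrary: G rule: less_induct)
  case less
  interpret group G by fact
  note fin = less.prems(2)
  have quotient: "\<exists>n. card (supersolvable_residual p Q) = p ^ n"
    if "finite_epimorphism G Q f" "kernel G Q f = N" "N \<lhd> G" "N \<noteq> {\<one>\<^bsub>G\<^esub>}" for Q :: "nat monoid" and f N
  proof -
    interpret f: finite_epimorphism G Q f by fact
    have "order Q < order G" using f.order_image_less that(2,4) by simp
    then show ?thesis
      using less.hyps[OF _ f.H.is_group f.finite_image f.p_solvable_image[OF less.prems(3)]
          f.norm_eq_carrier_image[OF less.prems(4)]] by simp
  qed
  have normal_p: ?case if P: "P \<lhd> G" "P \<noteq> {\<one>\<^bsub>G\<^esub>}" "card P = p ^ a" for P a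
  proof -
    obtain Q :: "nat monoid" and f where f: "finite_epimorphism G Q f" "kernel G Q f = P"
      using finite_epimorphism_nat[OF fin P(1)] .
    obtain b where b: "card (supersolvable_residual p Q) = p ^ b" using quotient[OF f P(1,2)] by blast
    show ?case
      using finite_epimorphism.residual_p_group_lift[OF f(1) p, of a b] P(3) f(2) b by simp
  qed
  show ?case
  proof (cases "p_supersolvable p G")
    case True
    then have "card (supersolvable_residual p G) = p ^ 0"
      using p_supersolvable_residual_trivial[OF fin] by simp
    then show ?thesis by blast
  next
    case False
    have "supersolvable_residual p G \<noteq> {\<one>\<^bsub>G\<^esub>}" using False p_supersolvable_residual_trivial[OF fin] by simp
    then obtain M where M: "chief_factor G M {\<one>\<^bsub>G\<^esub>}"
      using minimal_normal_exists[OF fin supersolvable_residual_normal(1)[OF fin]] by blast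
    note n = chief_factor_normal[OF M]
    have "(\<exists>a. card M = p ^ a) \<or> \<not> p dvd card M"
      using p_solvable_iff[OF fin] less.prems(3) M by fastforce
    then show ?thesis
    proof
      assume "\<exists>a. card M = p ^ a"
      then show ?thesis using normal_p[of M] n by blast
    next
      assume p': "\<not> p dvd card M"
      obtain Q :: "nat monoid" and f where f: "finite_epimorphism G Q f" "kernel G Q f = M"
        using finite_epimorphism_nat[OF fin n(1)] .
      interpret f: finite_epimorphism G Q f by (fact f(1))
      obtain m where m: "card (supersolvable_residual p Q) = p ^ m" using quotient[OF f n(1)] n(3) by blast
      obtain P where P: "P \<lhd> G" "card P = p ^ m"
        using f.normal_sylow_of_residual[OF p _ less.prems(4) m] p' f(2) by auto
      have "P \<noteq> {\<one>\<^bsub>G\<^esub>}"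
      proof
        assume "P = {\<one>\<^bsub>G\<^esub>}"
        then have "card (supersolvable_residual p Q) = 1" using P(2) m by simp
        moreover have "\<one>\<^bsub>Q\<^esub> \<in> supersolvable_residual p Q"
          using subgroup.one_closed[OF normal_imp_subgroup[OF
                f.H.supersolvable_residual_normal(1)[OF f.finite_image]]] .
        ultimately have "supersolvable_residual p Q = {\<one>\<^bsub>Q\<^esub>}"
          by (metis card_1_singletonE singletonD)
        then have "p_supersolvable p Q" using f.H.p_supersolvable_residual_trivial[OF f.finite_image] by simp
        then show False using f.p_supersolvable_p'_kernel p' f(2) False by simp
      qed
      then show ?thesis using normal_p P by blast
    qed
  qed
qed

lemma (in group) residual_p_group:
  assumes p: "Factorial_Ring.prime (p::nat)" and fin: "finite (carrier G)"
    and "p_solvable p G" "carrier G = supersolvable_norm p G"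
  shows "\<exists>n. card (supersolvable_residual p G) = p ^ n"
proof -
  obtain Q :: "nat monoid" and f where f: "finite_epimorphism G Q f" "kernel G Q f = {\<one>}"
    using finite_epimorphism_nat[OF fin one_is_normal] .
  interpret f: finite_epimorphism G Q f by (fact f(1))
  obtain b where b: "card (supersolvable_residual p Q) = p ^ b"
    using residual_p_group_nat[OF p f.H.is_group f.finite_image f.p_solvable_image f.norm_eq_carrier_image] assms(3,4)
    by blast
  show ?thesis using f.residual_p_group_lift[OF p, of 0 b] f(2) b by simp
qed

section \<open>The \<open>p\<close>-length of \<open>p\<close>-supersolvable groups\<close>

text \<open>
  A normal series \<open>1 \<le> K \<le> Y \<le> G\<close> with factors of type \<open>p'\<close>, \<open>p\<close>, \<open>p'\<close>, stated by orders: for finite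
  \<open>p\<close>-solvable groups this says that the \<open>p\<close>-length is at most one.
\<close>
definition p_length_le_one :: "nat \<Rightarrow> ('a, 'b) monoid_scheme \<Rightarrow> bool" where
  "p_length_le_one p G \<longleftrightarrow> (\<exists>K Y m c. K \<lhd> G \<and> Y \<lhd> G \<and> K \<subseteq> Y \<and>
     \<not> p dvd card K \<and> card Y = card K * p ^ m \<and> order G = card Y * c \<and> \<not> p dvd c)"

lemma (in finite_epimorphism) p_length_le_one_lift:
  assumes p: "Factorial_Ring.prime (p::nat)" and H: "p_length_le_one p H" and k: "\<not> p dvd card ker"
  shows "p_length_le_one p G"
proof -
  obtain K Y m c where 1: "K \<lhd> H" "Y \<lhd> H" "K \<subseteq> Y" "\<not> p dvd card K" "card Y = card K * p ^ m"
    "order H = card Y * c" "\<not> p dvd c"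
    using H unfolding p_length_le_one_def by blast
  have sg: "subgroup K H" "subgroup Y H" using 1(1,2) normal_imp_subgroup by auto
  have "\<not> p dvd card (pre K)" using p k 1(4) by (simp add: card_pre sg prime_dvd_mult_iff)
  moreover have "card (pre Y) = card (pre K) * p ^ m" using 1(5) by (simp add: card_pre sg)
  moreover have "order G = card (pre Y) * c" using order_image 1(6) by (simp add: card_pre sg mult.commute)
  ultimately show ?thesis
    unfolding p_length_le_one_def
    using normal_pre[OF 1(1)] normal_pre[OF 1(2)] pre_mono[OF 1(3)] 1(7) by blast
qed

lemma (in finite_epimorphism) index_image:
  assumes A: "subgroup A G" and B: "subgroup B G" and AB: "A \<subseteq> B" and r: "card B = card A * r"
  obtains r' where "card (h ` B) = card (h ` A) * r'" "r' dvd r"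
proof -
  have hA: "subgroup (h ` A) H" and hB: "subgroup (h ` B) H"
    using A B subgroup_img_is_subgroup by auto
  obtain r' where r': "card (h ` B) = card (h ` A) * r'"
    using H.card_subgroup_dvd[OF hA hB] AB by blast
  have k: "subgroup (A \<inter> ker) G" "subgroup (B \<inter> ker) G"
    using A B subgroup_kernel G.subgroups_Inter_pair by auto
  obtain e where e: "card (B \<inter> ker) = card (A \<inter> ker) * e"
    using G.card_subgroup_dvd[OF k] AB by blast
  have "card A * (r' * e) = card A * r"
    using card_image_ker[OF A] card_image_ker[OF B] r r' e by (simp add: algebra_simps flip: card_image_ker[OF A])
  then have "r = r' * e" using card_pos[OF A] by simp
  then show ?thesis using that[OF r'] by simp
qed

text \<open>
  Because \<open>M\<close> is generated by any nontrivial element \<open>m\<close>, its centralizer is the stabilizer of \<open>m\<close> under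
  conjugation; the orbit of \<open>m\<close> lies in \<open>M\<close> and avoids \<open>\<one>\<close>, so it has fewer than \<open>p\<close> elements.
\<close>
lemma (in group) centralizer_of_order_p:
  assumes p: "Factorial_Ring.prime (p::nat)" and fin: "finite (carrier G)"
    and M: "M \<lhd> G" "card M = p"
  defines "C \<equiv> {g \<in> carrier G. \<forall>m\<in>M. g \<otimes> m = m \<otimes> g}"
  shows "C \<lhd> G" and "M \<subseteq> C" and "\<exists>d. order G = card C * d \<and> \<not> p dvd d"
proof -
  have sM: "subgroup M G" using normal_imp_subgroup[OF M(1)] .
  have MG: "M \<subseteq> carrier G" using subgroup.subset[OF sM] .
  have finM: "finite M" using finite_subset[OF MG fin] .
  have "M \<noteq> {\<one>}" using M(2) p by (auto simp: prime_nat_iff)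
  then obtain m where m: "m \<in> M" "m \<noteq> \<one>" using subgroup.one_closed[OF sM] by blast
  have mG: "m \<in> carrier G" using m MG by auto
  \<comment> \<open>The elements of \<open>M\<close> commuting with \<open>g\<close> form a subgroup of a group of prime order.\<close>
  have all: "\<forall>x\<in>M. g \<otimes> x = x \<otimes> g" if g: "g \<in> carrier G" "g \<otimes> m = m \<otimes> g" for g
  proof -
    let ?S = "{x \<in> M. g \<otimes> x = x \<otimes> g}"
    have S: "subgroup ?S G"
    proof (rule subgroupI)
      show "?S \<subseteq> carrier G" "?S \<noteq> {}" using MG g m by auto
    next
      fix x assume x: "x \<in> ?S"
      then have xG: "x \<in> carrier G" using MG by auto
      have "g \<otimes> inv x = inv x \<otimes> (x \<otimes> g) \<otimes> inv x" using xG g(1) by (simp flip: m_assoc)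
      also have "\<dots> = inv x \<otimes> (g \<otimes> x) \<otimes> inv x" using x by simp
      also have "\<dots> = inv x \<otimes> g" using xG g(1) by (simp add: m_assoc)
      finally have "g \<otimes> inv x = inv x \<otimes> g" .
      then show "inv x \<in> ?S" using x subgroup.m_inv_closed[OF sM] by auto
    next
      fix x y assume x: "x \<in> ?S" and y: "y \<in> ?S"
      then have G: "x \<in> carrier G" "y \<in> carrier G" using MG by auto
      have "g \<otimes> (x \<otimes> y) = x \<otimes> (g \<otimes> y)" using x G g(1) by (simp flip: m_assoc)
      also have "\<dots> = (x \<otimes> y) \<otimes> g" using y G g(1) by (simp add: m_assoc)
      finally show "x \<otimes> y \<in> ?S" using x y subgroup.m_closed[OF sM] by auto
    qed
    have "card ?S dvd p" using card_subgroup_dvd[OF S sM] M(2) by auto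
    then have "card ?S = 1 \<or> card ?S = p" using p by (simp add: prime_nat_iff)
    moreover have "card ?S \<noteq> 1"
    proof
      assume "card ?S = 1"
      then obtain z where "?S = {z}" by (rule card_1_singletonE)
      moreover have "\<one> \<in> ?S" using subgroup.one_closed[OF S] .
      moreover have "m \<in> ?S" using m g by auto
      ultimately show False using m(2) by (metis singletonD)
    qed
    ultimately have "?S = M" using M(2) finM by (intro card_subset_eq) auto
    then show ?thesis by blast
  qed
  show MC: "M \<subseteq> C"
  proof
    fix x assume x: "x \<in> M"
    have xG: "x \<in> carrier G" using x MG by auto
    have "x \<otimes> m = m \<otimes> x" using bspec[OF all[OF mG refl] x] by simp
    then show "x \<in> C" using all[OF xG] xG by (simp add: C_def)
  qed
  have Cm: "C = stabilizer G (\<lambda>g. \<lambda>x\<in>carrier G. g \<otimes> x \<otimes> inv g) m"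
  proof (intro equalityI subsetI)
    fix g assume "g \<in> C"
    then show "g \<in> stabilizer G (\<lambda>g. \<lambda>x\<in>carrier G. g \<otimes> x \<otimes> inv g) m"
      using m mG by (auto simp: C_def stabilizer_def m_assoc)
  next
    fix g assume "g \<in> stabilizer G (\<lambda>g. \<lambda>x\<in>carrier G. g \<otimes> x \<otimes> inv g) m"
    then have g: "g \<in> carrier G" "g \<otimes> m \<otimes> inv g = m" using mG by (auto simp: stabilizer_def)
    have "g \<otimes> m \<otimes> inv g \<otimes> g = m \<otimes> g" unfolding g(2) ..
    then have "g \<otimes> m = m \<otimes> g" using g(1) mG by (simp add: m_assoc)
    then show "g \<in> C" using all g(1) by (auto simp: C_def)
  qed
  interpret act: group_action G "carrier G" "\<lambda>g. \<lambda>x\<in>carrier G. g \<otimes> x \<otimes> inv g"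
    by (rule action_by_conjugation)
  let ?O = "orbit G (\<lambda>g. \<lambda>x\<in>carrier G. g \<otimes> x \<otimes> inv g) m"
  have "?O \<subseteq> M - {\<one>}"
  proof
    fix y assume "y \<in> ?O"
    then obtain g where g: "g \<in> carrier G" "y = g \<otimes> m \<otimes> inv g" using mG by (auto simp: orbit_def)
    have "y \<in> M" using normal_invE(2)[OF M(1) g(1) m(1)] g(2) by simp
    moreover have "y \<noteq> \<one>"
    proof
      assume "y = \<one>"
      then have "g \<otimes> m = g" using g mG by (metis inv_equality inv_inv inv_closed m_closed)
      then show False using g(1) mG m(2) by simp
    qed
    ultimately show "y \<in> M - {\<one>}" by simp
  qed
  then have "card ?O \<le> card (M - {\<one>})" using finM by (intro card_mono) auto
  also have "\<dots> < p" using M(2) finM subgroup.one_closed[OF sM] p by (simp add: prime_gt_0_nat)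
  finally have lt: "card ?O < p" .
  have os: "order G = card C * card ?O" using act.orbit_stabilizer_theorem[OF mG] Cm by (simp add: mult.commute)
  moreover have "order G > 0" using fin order_gt_0_iff_finite by simp
  ultimately have "card ?O > 0" by simp
  then have "\<not> p dvd card ?O" using lt nat_dvd_not_less by blast
  then show "\<exists>d. order G = card C * d \<and> \<not> p dvd d" using os by blast
  have sC: "subgroup C G" unfolding Cm by (rule act.stabilizer_subgroup[OF mG])
  show "C \<lhd> G"
  proof (rule normal_invI[OF sC])
    fix g c assume g: "g \<in> carrier G" and c: "c \<in> C"
    have cG: "c \<in> carrier G" using c by (simp add: C_def)
    have "(g \<otimes> c \<otimes> inv g) \<otimes> x = x \<otimes> (g \<otimes> c \<otimes> inv g)" if x: "x \<in> M" for x
    proof -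
      have xG: "x \<in> carrier G" using x MG by auto
      have y: "inv g \<otimes> x \<otimes> g \<in> M" using normal.inv_op_closed1[OF M(1) g x] .
      have "(g \<otimes> c \<otimes> inv g) \<otimes> x = g \<otimes> (c \<otimes> (inv g \<otimes> x \<otimes> g)) \<otimes> inv g"
        using g cG xG by (simp add: m_assoc)
      also have "\<dots> = g \<otimes> ((inv g \<otimes> x \<otimes> g) \<otimes> c) \<otimes> inv g" using c y by (simp add: C_def)
      also have "\<dots> = (g \<otimes> inv g) \<otimes> x \<otimes> (g \<otimes> c \<otimes> inv g)"
        by (simp only: m_assoc m_closed inv_closed g cG xG)
      also have "\<dots> = x \<otimes> (g \<otimes> c \<otimes> inv g)" using g cG xG by simp
      finally show ?thesis .
    qed
    then show "g \<otimes> c \<otimes> inv g \<in> C" using g cG by (simp add: C_def)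
  qed
qed

text \<open>
  The complement of the central subgroup \<open>M\<close> in \<open>D\<close> is cut out by the equation \<open>x [^] n = \<one>\<close>, hence
  normal in \<open>G\<close>; its order is prime to \<open>p\<close>, so it must be trivial.
\<close>
lemma (in group) central_sylow_trivial:
  assumes p: "Factorial_Ring.prime (p::nat)" and fin: "finite (carrier G)"
    and D: "D \<lhd> G" and M: "subgroup M G" "M \<subseteq> D" "card M = p"
    and central: "\<And>m x. m \<in> M \<Longrightarrow> x \<in> D \<Longrightarrow> m \<otimes> x = x \<otimes> m"
    and cD: "card D = n * p" and n: "\<not> p dvd n"
    and no: "\<And>N. N \<lhd> G \<Longrightarrow> \<not> p dvd card N \<Longrightarrow> N = {\<one>}"
  shows "D = M"
proof -
  have sD: "subgroup D G" using normal_imp_subgroup[OF D] .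
  have DG: "D \<subseteq> carrier G" using subgroup.subset[OF sD] .
  have gD: "group (G\<lparr>carrier := D\<rparr>)" using subgroup_imp_group[OF sD] .
  have finD: "finite D" using finite_subset[OF DG fin] .
  have cop: "coprime n (card M)" using p n M(3) by (metis coprime_commute prime_imp_coprime)
  let ?E = "{x \<in> D. x [^] n = \<one>}"
  have E: "?E \<lhd> G\<lparr>carrier := D\<rparr>" "card ?E = n"
  proof -
    have c: "m \<otimes>\<^bsub>G\<lparr>carrier := D\<rparr>\<^esub> x = x \<otimes>\<^bsub>G\<lparr>carrier := D\<rparr>\<^esub> m"
      if "m \<in> M" "x \<in> carrier (G\<lparr>carrier := D\<rparr>)" for m x
      using central that by simp
    have f: "finite (carrier (G\<lparr>carrier := D\<rparr>))" and o: "order (G\<lparr>carrier := D\<rparr>) = n * card M"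
      using finD cD M(3) by (simp_all add: order_def)
    show "?E \<lhd> G\<lparr>carrier := D\<rparr>" "card ?E = n"
      using group.central_coprime_complement[OF gD f subgroup_incl[OF M(1) sD M(2)] c o cop]
      by (simp_all add: nat_pow_consistent[symmetric])
  qed
  have "?E \<lhd> G"
  proof (rule normal_invI)
    show "subgroup ?E G" using incl_subgroup[OF sD normal_imp_subgroup[OF E(1)]] .
    fix g x assume g: "g \<in> carrier G" and x: "x \<in> ?E"
    interpret c: group_hom G G "\<lambda>x. g \<otimes> x \<otimes> inv g" by (rule conjugation_hom[OF g])
    have xG: "x \<in> carrier G" using x DG by auto
    have "(g \<otimes> x \<otimes> inv g) [^] n = g \<otimes> x [^] n \<otimes> inv g"
      using c.hom_nat_pow[OF xG, of n] by simp
    also have "\<dots> = \<one>" using x g by simp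
    finally show "g \<otimes> x \<otimes> inv g \<in> ?E" using normal_invE(2)[OF D g] x by auto
  qed
  then have "?E = {\<one>}" using no E(2) n by simp
  then have "n = 1" using E(2) by simp
  then show ?thesis using card_subset_eq[OF finD M(2)] cD M(3) by simp
qed

text \<open>
  A nontrivial normal \<open>p'\<close>-subgroup can be factored out. Without one, a minimal normal subgroup \<open>M\<close> has
  order \<open>p\<close>; with \<open>C\<close> its centralizer and a series \<open>K \<le> Y\<close> of the quotient by \<open>M\<close>, the preimage of \<open>K\<close>
  meets \<open>C\<close> in a group with central Sylow subgroup \<open>M\<close>, which is therefore \<open>M\<close> itself. So the
  intersection \<open>Z\<close> of \<open>C\<close> with the preimage of \<open>Y\<close> is an extension of \<open>M\<close> by a \<open>p\<close>-group, and
  \<open>1 \<le> Z \<le> G\<close> does the job: the index of \<open>Z\<close> is prime to \<open>p\<close>, since \<open>C\<close> and the preimage of \<open>Y\<close> both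
  have index prime to \<open>p\<close>.
\<close>
lemma p_supersolvable_p_length_nat:
  fixes G :: "nat monoid"
  assumes p: "Factorial_Ring.prime (p::nat)"
  shows "group G \<Longrightarrow> finite (carrier G) \<Longrightarrow> p_supersolvable p G \<Longrightarrow> p_length_le_one p G"
proof (induction "order G" arbitrary: G rule: less_induct)
  case less
  interpret group G by fact
  note fin = less.prems(2)
  have quotient: "p_length_le_one p Q"
    if "finite_epimorphism G Q f" "kernel G Q f = N" "N \<lhd> G" "N \<noteq> {\<one>\<^bsub>G\<^esub>}" for Q :: "nat monoid" and f N
  proof -
    interpret f: finite_epimorphism G Q f by fact
    have "order Q < order G" using f.order_image_less that(2,4) by simp
    then show ?thesis
      using less.hyps[OF _ f.H.is_group f.finite_image f.p_supersolvable_image[OF less.prems(3)]] by simp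
  qed
  show ?case
  proof (cases "\<exists>N. N \<lhd> G \<and> \<not> p dvd card N \<and> N \<noteq> {\<one>\<^bsub>G\<^esub>}")
    case True
    then obtain N where N: "N \<lhd> G" "\<not> p dvd card N" "N \<noteq> {\<one>\<^bsub>G\<^esub>}" by blast
    obtain Q :: "nat monoid" and f where f: "finite_epimorphism G Q f" "kernel G Q f = N"
      using finite_epimorphism_nat[OF fin N(1)] .
    show ?thesis
      using finite_epimorphism.p_length_le_one_lift[OF f(1) p quotient[OF f N(1,3)]] f(2) N(2) by simp
  next
    case False
    then have no: "N = {\<one>\<^bsub>G\<^esub>}" if "N \<lhd> G" "\<not> p dvd card N" for N using that by blast
    have c1: "\<not> p dvd card {\<one>\<^bsub>G\<^esub>}" using p by (auto simp: prime_nat_iff)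
    show ?thesis
    proof (cases "carrier G = {\<one>\<^bsub>G\<^esub>}")
      case True
      then have "order G = card {\<one>\<^bsub>G\<^esub>} * 1" "card {\<one>\<^bsub>G\<^esub>} = card {\<one>\<^bsub>G\<^esub>} * p ^ 0" by (simp_all add: order_def)
      then show ?thesis
        unfolding p_length_le_one_def using one_is_normal c1 p
        by (intro exI[of _ "{\<one>\<^bsub>G\<^esub>}"] exI[of _ "0::nat"] exI[of _ "1::nat"]) (auto simp: prime_nat_iff)
    next
      case False
      obtain M where M: "chief_factor G M {\<one>\<^bsub>G\<^esub>}"
        using minimal_normal_exists[OF fin normal_self False] .
      note nM = chief_factor_normal[OF M]
      have sM: "subgroup M G" using normal_imp_subgroup[OF nM(1)] .
      have "supersolvable_ratio p (card M) (card {\<one>\<^bsub>G\<^esub>})"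
        using less.prems(3) M p_supersolvable_iff[OF fin] by blast
      then have cM: "card M = p" using no[OF nM(1)] nM(3) by (auto simp: supersolvable_ratio_def)
      obtain Q :: "nat monoid" and f where f: "finite_epimorphism G Q f" "kernel G Q f = M"
        using finite_epimorphism_nat[OF fin nM(1)] .
      interpret f: finite_epimorphism G Q f by (fact f(1))
      have "p_length_le_one p Q" using quotient[OF f nM(1)] nM(3) by blast
      then obtain K Y m c where 1: "K \<lhd> Q" "Y \<lhd> Q" "K \<subseteq> Y" "\<not> p dvd card K" "card Y = card K * p ^ m"
        "order Q = card Y * c" "\<not> p dvd c"
        unfolding p_length_le_one_def by blast
      have sg: "subgroup K Q" "subgroup Y Q" using 1(1,2) normal_imp_subgroup by auto
      define C where "C = {g \<in> carrier G. \<forall>m\<in>M. g \<otimes>\<^bsub>G\<^esub> m = m \<otimes>\<^bsub>G\<^esub> g}"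
      have C: "C \<lhd> G" "M \<subseteq> C" and "\<exists>d. order G = card C * d \<and> \<not> p dvd d"
        using centralizer_of_order_p[OF p fin nM(1) cM] by (simp_all add: C_def)
      then obtain d where d: "order G = card C * d" "\<not> p dvd d" by blast
      have sC: "subgroup C G" using normal_imp_subgroup[OF C(1)] .
      have MK: "M \<subseteq> f.pre K" using f.ker_subset_pre[OF sg(1)] f(2) by simp
      have D: "f.pre K \<inter> C \<lhd> G" using f.normal_pre[OF 1(1)] C(1) normal_subgroup_intersect by blast
      have sD: "subgroup (f.pre K \<inter> C) G" using normal_imp_subgroup[OF D] .
      obtain n where n: "card (f.pre K \<inter> C) = n * p"
        using card_subgroup_dvd[OF sM sD] MK C(2) cM by (metis dvd_def le_inf_iff mult.commute)
      have "n * p dvd card K * p"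
        using card_subgroup_dvd[OF sD f.subgroup_pre[OF sg(1)]] n f.card_pre[OF sg(1)] f(2) cM by simp
      then have "n dvd card K" using prime_gt_0_nat[OF p] by simp
      then have pn: "\<not> p dvd n" using 1(4) dvd_trans by blast
      have DM: "f.pre K \<inter> C = M"
      proof (rule central_sylow_trivial[OF p fin D sM _ cM _ n])
        show "M \<subseteq> f.pre K \<inter> C" using MK C(2) by simp
        show "y \<otimes>\<^bsub>G\<^esub> x = x \<otimes>\<^bsub>G\<^esub> y" if "y \<in> M" "x \<in> f.pre K \<inter> C" for y x
          using that by (simp add: C_def)
      qed (use pn no in auto)
      let ?Z = "f.pre Y \<inter> C"
      have Z: "?Z \<lhd> G" using f.normal_pre[OF 1(2)] C(1) normal_subgroup_intersect by blast
      have sZ: "subgroup ?Z G" using normal_imp_subgroup[OF Z] .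
      have fZ: "subgroup (f ` ?Z) Q" using f.subgroup_img_is_subgroup[OF sZ] .
      \<comment> \<open>As the image of \<open>Z\<close> meets \<open>K\<close> trivially, it embeds into the \<open>p\<close>-group \<open>Y/K\<close>.\<close>
      interpret q: finite_epimorphism Q "Q Mod K" "\<lambda>x. K #>\<^bsub>Q\<^esub> x"
        by (rule f.H.finite_epimorphism_Mod(1)[OF f.finite_image 1(1)])
      have kq: "q.ker = K" by (rule f.H.finite_epimorphism_Mod(2)[OF f.finite_image 1(1)])
      have "f ` ?Z \<inter> K = {\<one>\<^bsub>Q\<^esub>}"
      proof
        show "f ` ?Z \<inter> K \<subseteq> {\<one>\<^bsub>Q\<^esub>}"
        proof clarify
          fix z assume z: "f z \<in> K" "z \<in> f.pre Y" "z \<in> C"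
          then have "z \<in> f.ker" using DM f(2) by (auto simp: f.pre_def)
          then show "f z = \<one>\<^bsub>Q\<^esub>" by (simp add: f.mem_ker)
        qed
        show "{\<one>\<^bsub>Q\<^esub>} \<subseteq> f ` ?Z \<inter> K"
          using subgroup.one_closed[OF fZ] subgroup.one_closed[OF sg(1)] by simp
      qed
      then have cK: "card ((\<lambda>x. K #>\<^bsub>Q\<^esub> x) ` f ` ?Z) = card (f ` ?Z)"
        using q.card_image_ker[OF fZ] kq by simp
      have "card ((\<lambda>x. K #>\<^bsub>Q\<^esub> x) ` Y) = p ^ m"
        using q.card_image_ker[OF sg(2)] kq 1(3,5) q.card_pos[OF sg(1)] by (simp add: Int_absorb1 mult.commute)
      moreover have "card ((\<lambda>x. K #>\<^bsub>Q\<^esub> x) ` f ` ?Z) dvd card ((\<lambda>x. K #>\<^bsub>Q\<^esub> x) ` Y)"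
        using q.subgroup_img_is_subgroup[OF fZ] q.subgroup_img_is_subgroup[OF sg(2)]
        by (intro q.H.card_subgroup_dvd) (auto simp: f.pre_def)
      ultimately have "card (f ` ?Z) dvd p ^ m" using cK by simp
      then obtain j where j: "card (f ` ?Z) = p ^ j" using p divides_primepow_nat by blast
      have "M \<subseteq> ?Z" using C(2) f.ker_subset_pre[OF sg(2)] f(2) by simp
      then have cZ: "card ?Z = p ^ (Suc j)"
        using f.card_image_ker[OF sZ] f(2) cM j by (simp add: Int_absorb1 Int_absorb2 mult.commute)
      have sY: "subgroup (f.pre Y) G" using f.subgroup_pre[OF sg(2)] .
      obtain e where e: "card C = card ?Z * e" "e dvd c"
      proof -
        have nY: "f.pre Y \<lhd> G" using f.normal_pre[OF 1(2)] .
        interpret r: finite_epimorphism G "G Mod f.pre Y" "\<lambda>x. f.pre Y #>\<^bsub>G\<^esub> x"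
          by (rule finite_epimorphism_Mod(1)[OF fin nY])
        have kr: "r.ker = f.pre Y" by (rule finite_epimorphism_Mod(2)[OF fin nY])
        have "order G = card (f.pre Y) * c"
          using f.order_image 1(6) f.card_pre[OF sg(2)] by (simp add: mult.commute)
        then have "order (G Mod f.pre Y) = c"
          using r.order_image kr r.card_pos[OF sY] by simp
        then have "card ((\<lambda>x. f.pre Y #>\<^bsub>G\<^esub> x) ` C) dvd c"
          using r.H.card_subgroup_dvd[OF r.subgroup_img_is_subgroup[OF sC] r.H.subgroup_self]
            subgroup.subset[OF r.subgroup_img_is_subgroup[OF sC]] by (simp add: order_def)
        moreover have "card C = card ?Z * card ((\<lambda>x. f.pre Y #>\<^bsub>G\<^esub> x) ` C)"
          using r.card_image_ker[OF sC] kr by (simp add: mult.commute Int_commute)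
        ultimately show ?thesis using that by blast
      qed
      have "order G = card ?Z * (e * d)" using d(1) e(1) by simp
      moreover have "\<not> p dvd e * d" using d(2) dvd_trans[OF _ e(2)] 1(7) prime_dvd_mult_iff[OF p] by blast
      moreover have "card ?Z = card {\<one>\<^bsub>G\<^esub>} * p ^ Suc j" using cZ by simp
      moreover have "{\<one>\<^bsub>G\<^esub>} \<subseteq> ?Z" using subgroup.one_closed[OF sZ] by simp
      ultimately show ?thesis
        unfolding p_length_le_one_def using one_is_normal Z c1 by blast
    qed
  qed
qed

lemma (in group) p_supersolvable_p_length:
  assumes p: "Factorial_Ring.prime (p::nat)" and fin: "finite (carrier G)" and "p_supersolvable p G"
  shows "p_length_le_one p G"
proof -
  obtain Q :: "nat monoid" and f where f: "finite_epimorphism G Q f" "kernel G Q f = {\<one>}"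
    using finite_epimorphism_nat[OF fin one_is_normal] .
  interpret f: finite_epimorphism G Q f by (fact f(1))
  have "p_length_le_one p Q"
    using p_supersolvable_p_length_nat[OF p f.H.is_group f.finite_image f.p_supersolvable_image] assms(3) by blast
  then show ?thesis using f.p_length_le_one_lift[OF p] f(2) p by (auto simp: prime_nat_iff)
qed

section \<open>The \<open>p\<close>-Fitting series\<close>

lemma (in group) normal_generate_Union:
  assumes "\<And>N. N \<in> \<F> \<Longrightarrow> N \<lhd> G"
  shows "generate G (\<Union>\<F>) \<lhd> G"
proof (rule normal_generateI)
  show "\<Union>\<F> \<subseteq> carrier G" using assms normal_imp_subgroup subgroup.subset by (metis Union_least)
  fix h g assume "h \<in> \<Union>\<F>" and g: "g \<in> carrier G"
  then obtain N where N: "N \<in> \<F>" "h \<in> N" by blast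
  then show "g \<otimes> h \<otimes> inv g \<in> \<Union>\<F>" using normal_invE(2)[OF assms[OF N(1)] g N(2)] by blast
qed

lemma (in group) O_p_normal: "O_p p G \<lhd> G" and O_p'_normal: "O_p' p G \<lhd> G"
  unfolding O_p_def O_p'_def by (auto intro!: normal_generate_Union)

lemma (in group) subset_O_p:
  assumes N: "N \<lhd> G" and c: "card N = p ^ n"
  shows "N \<subseteq> O_p p G"
proof -
  have "is_p_group p (G\<lparr>carrier := N\<rparr>)"
    using subgroup_imp_group[OF normal_imp_subgroup[OF N]] c by (auto simp: is_p_group_def order_def)
  then show ?thesis using N unfolding O_p_def by (auto intro: generate.incl)
qed

lemma (in group) subset_O_p':
  assumes N: "N \<lhd> G" and c: "\<not> p dvd card N"
  shows "N \<subseteq> O_p' p G"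
proof -
  have "is_p'_group p (G\<lparr>carrier := N\<rparr>)"
    using subgroup_imp_group[OF normal_imp_subgroup[OF N]] c by (auto simp: is_p'_group_def order_def)
  then show ?thesis using N unfolding O_p'_def by (auto intro: generate.incl)
qed

lemma (in group) p_Fitting_normal:
  assumes fin: "finite (carrier G)" shows "p_Fitting p G \<lhd> G"
proof -
  interpret q: finite_epimorphism G "G Mod O_p' p G" "\<lambda>x. O_p' p G #> x"
    by (rule finite_epimorphism_Mod(1)[OF fin O_p'_normal])
  have "p_Fitting p G = q.pre (O_p p (G Mod O_p' p G))"
    by (simp add: p_Fitting_def q.pre_def)
  then show ?thesis using q.normal_pre[OF q.H.O_p_normal] by simp
qed

lemma (in group) p_Fitting_series_normal:
  assumes fin: "finite (carrier G)" shows "p_Fitting_series p G i \<lhd> G"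
proof (induction i)
  case 0
  then show ?case using one_is_normal by simp
next
  case (Suc i)
  let ?F = "p_Fitting_series p G i"
  interpret q: finite_epimorphism G "G Mod ?F" "\<lambda>x. ?F #> x"
    by (rule finite_epimorphism_Mod(1)[OF fin Suc])
  have "p_Fitting_series p G (Suc i) = q.pre (p_Fitting p (G Mod ?F))"
    by (simp add: q.pre_def)
  then show ?case using q.normal_pre[OF q.H.p_Fitting_normal[OF q.finite_image]] by simp
qed

lemma (in finite_epimorphism) image_subset_ker:
  assumes "subgroup A G" "A \<subseteq> ker" shows "card (h ` A) = 1"
proof -
  have "h ` A = {\<one>\<^bsub>H\<^esub>}"
    using assms(2) subgroup.one_closed[OF assms(1)] hom_one by (force simp: mem_ker)
  then show ?thesis by simp
qed

text \<open>
  Modulo \<open>p_Fitting_series p G i\<close> the subgroup \<open>K\<close> becomes a normal \<open>p'\<close>-group, so it vanishes in the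
  further quotient by \<open>O_p'\<close>; what is left there of \<open>Y\<close> is a normal \<open>p\<close>-group.
\<close>
lemma (in group) p_Fitting_series_step:
  assumes p: "Factorial_Ring.prime (p::nat)" and fin: "finite (carrier G)"
    and A: "A \<lhd> G" and K: "K \<lhd> G" and Y: "Y \<lhd> G" and AK: "A \<subseteq> K" and KY: "K \<subseteq> Y"
    and AF: "A \<subseteq> p_Fitting_series p G i"
    and cK: "card K = card A * k" "\<not> p dvd k" and cY: "card Y = card K * p ^ m"
  shows "Y \<subseteq> p_Fitting_series p G (Suc i)"
proof -
  let ?F = "p_Fitting_series p G i" and ?q = "\<lambda>x. p_Fitting_series p G i #> x"
  let ?G = "G Mod ?F"
  have F: "?F \<lhd> G" by (rule p_Fitting_series_normal[OF fin])
  interpret q: finite_epimorphism G ?G ?q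
    by (rule finite_epimorphism_Mod(1)[OF fin F])
  have kq: "q.ker = ?F" by (rule finite_epimorphism_Mod(2)[OF fin F])
  let ?O = "O_p' p ?G" and ?r = "\<lambda>x. O_p' p ?G #>\<^bsub>?G\<^esub> x"
  have O: "?O \<lhd> ?G" by (rule q.H.O_p'_normal)
  interpret r: finite_epimorphism ?G "?G Mod ?O" ?r
    by (rule q.H.finite_epimorphism_Mod(1)[OF q.finite_image O])
  have kr: "r.ker = ?O" by (rule q.H.finite_epimorphism_Mod(2)[OF q.finite_image O])
  have sg: "subgroup A G" "subgroup K G" "subgroup Y G" using A K Y normal_imp_subgroup by auto
  obtain k' where k': "card (?q ` K) = card (?q ` A) * k'" "k' dvd k"
    using q.index_image[OF sg(1,2) AK cK(1)] .
  have "card (?q ` A) = 1" using q.image_subset_ker[OF sg(1)] AF kq by simp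
  then have "\<not> p dvd card (?q ` K)" using k' cK(2) dvd_trans by auto
  then have KO: "?q ` K \<subseteq> ?O" by (rule q.H.subset_O_p'[OF q.normal_image[OF K]])
  obtain s where s: "card (?q ` Y) = card (?q ` K) * s" "s dvd p ^ m"
    using q.index_image[OF sg(2,3) KY cY] .
  have sK: "subgroup (?q ` K) ?G" and sY: "subgroup (?q ` Y) ?G"
    using sg q.subgroup_img_is_subgroup by auto
  obtain s' where s': "card (?r ` ?q ` Y) = card (?r ` ?q ` K) * s'" "s' dvd s"
    using r.index_image[OF sK sY image_mono[OF KY] s(1)] .
  have "card (?r ` ?q ` K) = 1" using r.image_subset_ker[OF sK] KO kr by simp
  then have "card (?r ` ?q ` Y) dvd p ^ m" using s' s(2) dvd_trans by simp
  then obtain j where "card (?r ` ?q ` Y) = p ^ j" using p divides_primepow_nat by blast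
  then have "?r ` ?q ` Y \<subseteq> O_p p (?G Mod ?O)"
    by (rule r.H.subset_O_p[OF r.normal_image[OF q.normal_image[OF Y]]])
  then have "?q ` Y \<subseteq> p_Fitting p ?G"
    using subgroup.subset[OF sY] by (auto simp: p_Fitting_def)
  then show ?thesis using subgroup.subset[OF sg(3)] by auto
qed

text \<open>
  The series \<open>1 \<le> R \<le> K \<le> Y \<le> G\<close> has factors \<open>p\<close>, \<open>p'\<close>, \<open>p\<close>, \<open>p'\<close>. Each term of the \<open>p\<close>-Fitting series
  absorbs one \<open>p'\<close>-factor followed by one \<open>p\<close>-factor, where the first \<open>p'\<close>-factor and the last
  \<open>p\<close>-factor are trivial.
\<close>
lemma (in group) p_Fitting_length_le_3:
  assumes p: "Factorial_Ring.prime (p::nat)" and fin: "finite (carrier G)"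
    and R: "R \<lhd> G" "card R = p ^ a" and Q: "p_length_le_one p (G Mod R)"
  shows "p_Fitting_length p G \<le> 3"
proof -
  interpret q: finite_epimorphism G "G Mod R" "\<lambda>x. R #> x"
    by (rule finite_epimorphism_Mod(1)[OF fin R(1)])
  have kq: "q.ker = R" by (rule finite_epimorphism_Mod(2)[OF fin R(1)])
  obtain K Y m c where 1: "K \<lhd> G Mod R" "Y \<lhd> G Mod R" "K \<subseteq> Y" "\<not> p dvd card K"
    "card Y = card K * p ^ m" "order (G Mod R) = card Y * c" "\<not> p dvd c"
    using Q unfolding p_length_le_one_def by blast
  have sg: "subgroup K (G Mod R)" "subgroup Y (G Mod R)" using 1(1,2) normal_imp_subgroup by auto
  note n = q.normal_pre[OF 1(1)] q.normal_pre[OF 1(2)]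
  have p1: "\<not> p dvd 1" using p by (auto simp: prime_nat_iff)
  have F1: "R \<subseteq> p_Fitting_series p G (Suc 0)"
    using R subgroup.one_closed[OF normal_imp_subgroup[OF R(1)]] p1
    by (intro p_Fitting_series_step[OF p fin one_is_normal one_is_normal, of R 0 1 a]) auto
  have F2: "q.pre Y \<subseteq> p_Fitting_series p G (Suc (Suc 0))"
    using q.ker_subset_pre[OF sg(1)] kq 1(4,5) F1 q.pre_mono[OF 1(3)]
    by (intro p_Fitting_series_step[OF p fin R(1) n, of _ "card K" m])
      (auto simp: q.card_pre sg mult.commute simp del: p_Fitting_series.simps)
  have "carrier G \<subseteq> p_Fitting_series p G (Suc (Suc (Suc 0)))"
  proof (rule p_Fitting_series_step[OF p fin n(2) normal_self normal_self _ _ F2])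
    show "card (carrier G) = card (q.pre Y) * c"
      using q.order_image 1(6) by (simp add: q.card_pre sg order_def mult.commute)
    show "card (carrier G) = card (carrier G) * p ^ 0" by simp
  qed (use 1(7) in \<open>auto simp: q.pre_def\<close>)
  moreover have "p_Fitting_series p G (Suc (Suc (Suc 0))) \<subseteq> carrier G" by auto
  ultimately have "p_Fitting_series p G 3 = carrier G" by (simp only: numeral_3_eq_3 subset_antisym)
  then show ?thesis unfolding p_Fitting_length_def by (intro Least_le) simp
qed

section \<open>The norm equal to the group\<close>

theorem theorem4p10:
  fixes G :: "('a, 'b) monoid_scheme" and p :: nat
  assumes "Factorial_Ring.prime p"
    and "group G" and "finite (carrier G)"
    and "p_solvable p G"
    and "carrier G = supersolvable_norm p G"
  shows "is_p_group p (G\<lparr>carrier := supersolvable_residual p G\<rparr>)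
    \<and> (\<forall>N. N \<lhd> G \<longrightarrow> N \<noteq> carrier G \<longrightarrow>
          {\<one>\<^bsub>G Mod N\<^esub>} \<subset> supersolvable_norm p (G Mod N))
    \<and> p_Fitting_length p G \<le> 3"
proof (intro conjI allI impI)
  note p = assms(1) and fin = assms(3)
  interpret group G by fact
  let ?R = "supersolvable_residual p G"
  have R: "?R \<lhd> G" "p_supersolvable p (G Mod ?R)"
    by (rule supersolvable_residual_normal[OF fin])+
  obtain n where n: "card ?R = p ^ n" using residual_p_group[OF p fin assms(4,5)] by blast
  show "is_p_group p (G\<lparr>carrier := ?R\<rparr>)"
    using subgroup_imp_group[OF normal_imp_subgroup[OF R(1)]] n by (auto simp: is_p_group_def order_def)
  interpret r: finite_epimorphism G "G Mod ?R" "\<lambda>x. ?R #>\<^bsub>G\<^esub> x"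
    by (rule finite_epimorphism_Mod(1)[OF fin R(1)])
  show "p_Fitting_length p G \<le> 3"
    by (rule p_Fitting_length_le_3[OF p fin R(1) n])
      (rule r.H.p_supersolvable_p_length[OF p r.finite_image R(2)])
  fix N assume N: "N \<lhd> G" "N \<noteq> carrier G"
  interpret q: finite_epimorphism G "G Mod N" "\<lambda>x. N #>\<^bsub>G\<^esub> x"
    by (rule finite_epimorphism_Mod(1)[OF fin N(1)])
  have kq: "q.ker = N" by (rule finite_epimorphism_Mod(2)[OF fin N(1)])
  have "carrier (G Mod N) \<noteq> {\<one>\<^bsub>G Mod N\<^esub>}"
  proof
    assume triv: "carrier (G Mod N) = {\<one>\<^bsub>G Mod N\<^esub>}"
    have "carrier G \<subseteq> q.ker"
    proof
      fix x assume x: "x \<in> carrier G"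
      then show "x \<in> q.ker" using q.hom_closed[OF x] triv unfolding q.mem_ker by blast
    qed
    then show False using kq N(2) subgroup.subset[OF normal_imp_subgroup[OF N(1)]] by blast
  qed
  then show "{\<one>\<^bsub>G Mod N\<^esub>} \<subset> supersolvable_norm p (G Mod N)"
    using q.norm_eq_carrier_image[OF assms(5)] q.H.one_closed by blast
qed

end
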